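(* Given any fair division instance $\mathcal{I}=\langle [n],[m],\{v_i\}_{i=1}^n \rangle$ with range parameter $\gamma \in (0,1]$, the algorithm LaBase (described in the context) computes a $\left(\frac{2\gamma}{\sqrt{5+4\gamma}-1}\right)$-approximately EFx allocation in polynomial time.
   Context: Instances. A fair division instance $\langle [n],[m],\{v_i\}_{i=1}^n\rangle$ consists of agents $[n]=\{1,\dots,n\}$, indivisible goods $[m]=\{1,\dots,m\}$, and additive valuations $v_i:2^{[m]}\to\mathbb{R}_{\ge 0}$, i.e. $v_i(S)=\sum_{g\in S}v_i(g)$. Let $P_i=\{g\in[m] : v_i(g)>0\}$. Throughout, $P_i\neq\emptyset$ for every agent $i$, and every good has positive value for at least one agent. Write $S+g=S\cup\{g\}$, $S-g=S\setminus\{g\}$. Range parameter and base values. For a good $g$, $\gamma_g=\frac{\min_{j:v_j(g)>0}v_j(g)}{\max_i v_i(g)}$; the range parameter of the instance is $\gamma=\min_{g\in[m]}\gamma_g$. The base value of $g$ is $\overline{v}(g)=\sqrt{\gamma_g}\,\max_i v_i(g)$. Allocations. An allocation $\mathcal{A}=(A_1,\dots,A_n)$ is a tuple of pairwise disjoint subsets of $[m]$ with $\bigcup_i A_i=[m]$; it is a partial allocation if the union may be a strict subset of $[m]$. For $\alpha\in(0,1)$, $\mathcal{A}$ is $\alpha$-approximately EFx ($\alpha$-EFx) if for all agents $i,j$ and every good $g\in A_j\cap P_i$ we have $v_i(A_i)\ge\alpha\,v_i(A_j-g)$; $\alpha=1$ gives exact EFx. Envy graph. For a partial allocation $\mathcal{A}$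 and $N\subseteq[n]$, $\mathcal{G}(N,\mathcal{A})$ is the directed graph on vertex set $N$ with an edge $i\to j$ iff $v_i(A_i)<v_i(A_j)$. Resolving envy cycles means: while there is a cycle $i_1\to i_2\to\dots\to i_k\to i_1$, give each $i_t$ the bundle of $i_{t+1}$ (and $i_k$ the bundle of $i_1$), all other bundles unchanged, until the graph is acyclic (polynomially many steps suffice). A source is a vertex with no incoming edge. Algorithm LaBase. Set $\eta=\frac{\sqrt{5+4\gamma}-1}{2}$, $A_i=\emptyset$ for all $i$, $U=[m]$ (unassigned goods), $Z=[n]$ (agents with empty bundle). While $U\ne\emptyset$: select $\widehat g\in\arg\max_{h\in U}\overline v(h)$. (If-case) If some agent $i\in Z$ has $v_i(\widehat g)>0$: pick such an $i$, let $U_\eta=\{g\in U:\overline v(g)\ge\eta\max_{h\in U}\overline v(h)\}$, choose $f_i\in\arg\max_{h\in U_\eta}v_i(h)$, set $A_i=\{f_i\}$, $Z\leftarrow Z-i$, $U\leftarrow U-f_i$. (Else-if case) Otherwise ($v_i(\widehat g)=0$ for all $i\in Z$): resolve all envy cycles in $\mathcal{G}([n]\setminus Z,\mathcal{A})$, let $s\in[n]\setminus Z$ be a source of the resulting graph, set $A_s\leftarrow A_s+\widehat g$, $U\leftarrow U-\widehat g$. Return $\mathcal{A}=(A_1,\dots,A_n)$. Ties and choices are arbitrary. *)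

theory Defs
  imports Complex_Main "HOL-Library.Disjoint_Sets" "HOL-Computational_Algebra.Polynomial"
begin

section \<open>Fair division instances\<close>

text \<open>Agents are \<open>{1..n}\<close>, goods are \<open>{1..m}\<close>. The additive valuation of agent \<open>i\<close> is given by
  its values \<open>v i g\<close> on single goods; its value on a bundle is \<open>val v i S\<close>.\<close>

definition val :: "(nat \<Rightarrow> nat \<Rightarrow> real) \<Rightarrow> nat \<Rightarrow> nat set \<Rightarrow> real" where
  "val v i S = (\<Sum>g\<in>S. v i g)"

definition pos_goods :: "nat \<Rightarrow> (nat \<Rightarrow> nat \<Rightarrow> real) \<Rightarrow> nat \<Rightarrow> nat set" where
  "pos_goods m v i = {g \<in> {1..m}. v i g > 0}"

definition fair_division_instance :: "nat \<Rightarrow> nat \<Rightarrow> (nat \<Rightarrow> nat \<Rightarrow> real) \<Rightarrow> bool" where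
  "fair_division_instance n m v \<longleftrightarrow>
     n \<ge> 1 \<and>
     (\<forall>i\<in>{1..n}. \<forall>g\<in>{1..m}. v i g \<ge> 0) \<and>
     (\<forall>i\<in>{1..n}. pos_goods m v i \<noteq> {}) \<and>
     (\<forall>g\<in>{1..m}. \<exists>i\<in>{1..n}. v i g > 0)"

definition max_value :: "nat \<Rightarrow> (nat \<Rightarrow> nat \<Rightarrow> real) \<Rightarrow> nat \<Rightarrow> real" where
  "max_value n v g = Max ((\<lambda>i. v i g) ` {1..n})"

definition good_range :: "nat \<Rightarrow> (nat \<Rightarrow> nat \<Rightarrow> real) \<Rightarrow> nat \<Rightarrow> real" where
  "good_range n v g = Min ((\<lambda>j. v j g) ` {j \<in> {1..n}. v j g > 0}) / max_value n v g"

definition range_param :: "nat \<Rightarrow> nat \<Rightarrow> (nat \<Rightarrow> nat \<Rightarrow> real) \<Rightarrow> real" where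
  "range_param n m v = Min (good_range n v ` {1..m})"

definition base_value :: "nat \<Rightarrow> (nat \<Rightarrow> nat \<Rightarrow> real) \<Rightarrow> nat \<Rightarrow> real" where
  "base_value n v g = sqrt (good_range n v g) * max_value n v g"

definition allocation :: "nat \<Rightarrow> nat \<Rightarrow> (nat \<Rightarrow> nat set) \<Rightarrow> bool" where
  "allocation n m A \<longleftrightarrow> disjoint_family_on A {1..n} \<and> (\<Union>i\<in>{1..n}. A i) = {1..m}"

definition approx_efx ::
    "real \<Rightarrow> nat \<Rightarrow> nat \<Rightarrow> (nat \<Rightarrow> nat \<Rightarrow> real) \<Rightarrow> (nat \<Rightarrow> nat set) \<Rightarrow> bool" where
  "approx_efx \<alpha> n m v A \<longleftrightarrow>
     (\<forall>i\<in>{1..n}. \<forall>j\<in>{1..n}. \<forall>g \<in> A j \<inter> pos_goods m v i.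
        val v i (A i) \<ge> \<alpha> * val v i (A j - {g}))"


section \<open>Envy graphs and rotations along envy cycles\<close>

definition envy_graph ::
    "(nat \<Rightarrow> nat \<Rightarrow> real) \<Rightarrow> nat set \<Rightarrow> (nat \<Rightarrow> nat set) \<Rightarrow> (nat \<times> nat) set" where
  "envy_graph v N A = {(i, j). i \<in> N \<and> j \<in> N \<and> val v i (A i) < val v i (A j)}"

definition simple_cycle :: "('a \<times> 'a) set \<Rightarrow> 'a list \<Rightarrow> bool" where
  "simple_cycle E c \<longleftrightarrow> c \<noteq> [] \<and> distinct c \<and>
     (\<forall>t<length c. (c ! t, c ! ((t + 1) mod length c)) \<in> E)"

definition rotate_bundles :: "nat list \<Rightarrow> (nat \<Rightarrow> nat set) \<Rightarrow> (nat \<Rightarrow> nat set) \<Rightarrow> bool" where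
  "rotate_bundles c A A' \<longleftrightarrow>
     (\<forall>t<length c. A' (c ! t) = A (c ! ((t + 1) mod length c))) \<and>
     (\<forall>i. i \<notin> set c \<longrightarrow> A' i = A i)"

definition source :: "nat set \<Rightarrow> (nat \<times> nat) set \<Rightarrow> nat \<Rightarrow> bool" where
  "source N E s \<longleftrightarrow> s \<in> N \<and> (\<forall>i\<in>N. (i, s) \<notin> E)"


section \<open>The algorithm LaBase as a transition system\<close>

definition eta :: "real \<Rightarrow> real" where
  "eta \<gamma> = (sqrt (5 + 4 * \<gamma>) - 1) / 2"

definition near_top :: "nat \<Rightarrow> nat \<Rightarrow> (nat \<Rightarrow> nat \<Rightarrow> real) \<Rightarrow> nat set \<Rightarrow> nat set" where
  "near_top n m v U =
     {g \<in> U. base_value n v g \<ge> eta (range_param n m v) * Max (base_value n v ` U)}"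

text \<open>\<open>Loop A U Z\<close> is the state at the loop head: current bundles, unassigned goods, agents with
  empty bundle. \<open>Resolve A U Z g\<close> is the state inside the else-if case, after the good \<open>g\<close> has been
  selected and while envy cycles are being resolved. Every choice left open by the algorithm is a
  nondeterministic choice of the next state.\<close>

datatype config =
    Loop "nat \<Rightarrow> nat set" "nat set" "nat set"
  | Resolve "nat \<Rightarrow> nat set" "nat set" "nat set" nat

inductive labase_step :: "nat \<Rightarrow> nat \<Rightarrow> (nat \<Rightarrow> nat \<Rightarrow> real) \<Rightarrow> config \<Rightarrow> config \<Rightarrow> bool"
  for n m v where
    if_case:
      "\<lbrakk> is_arg_max (base_value n v) (\<lambda>h. h \<in> U) g;
         i \<in> Z; v i g > 0;
         is_arg_max (v i) (\<lambda>h. h \<in> near_top n m v U) f \<rbrakk>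
       \<Longrightarrow> labase_step n m v (Loop A U Z) (Loop (A(i := {f})) (U - {f}) (Z - {i}))"
  | else_case:
      "\<lbrakk> is_arg_max (base_value n v) (\<lambda>h. h \<in> U) g;
         \<forall>i\<in>Z. v i g = 0 \<rbrakk>
       \<Longrightarrow> labase_step n m v (Loop A U Z) (Resolve A U Z g)"
  | rotate:
      "\<lbrakk> simple_cycle (envy_graph v ({1..n} - Z) A) c; rotate_bundles c A A' \<rbrakk>
       \<Longrightarrow> labase_step n m v (Resolve A U Z g) (Resolve A' U Z g)"
  | assign:
      "\<lbrakk> acyclic (envy_graph v ({1..n} - Z) A);
         source ({1..n} - Z) (envy_graph v ({1..n} - Z) A) s \<rbrakk>
       \<Longrightarrow> labase_step n m v (Resolve A U Z g) (Loop (A(s := insert g (A s))) (U - {g}) Z)"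

definition labase_init :: "nat \<Rightarrow> nat \<Rightarrow> config" where
  "labase_init n m = Loop (\<lambda>_. {}) {1..m} {1..n}"

definition labase_output ::
    "nat \<Rightarrow> nat \<Rightarrow> (nat \<Rightarrow> nat \<Rightarrow> real) \<Rightarrow> (nat \<Rightarrow> nat set) \<Rightarrow> bool" where
  "labase_output n m v A \<longleftrightarrow> (\<exists>Z. (labase_step n m v)\<^sup>*\<^sup>* (labase_init n m) (Loop A {} Z))"


section \<open>A real random access machine\<close>

text \<open>The values of an instance are arbitrary reals, so running time is measured on a real RAM,
  programmed in a small while-language. Memory consists of arrays of naturals and arrays of reals.
  An array is named by a number fixed in the program text and has two indices, computed at run time;
  scalars are entries at index \<open>0, 0\<close>. The only operations on reals are the ordered field operations,
  the only constants are naturals, and reals cannot be converted to naturals. Naturals are only added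
  and subtracted, so that they cannot become superpolynomially long in polynomial time.\<close>

type_synonym loc = "nat \<times> nat \<times> nat"

record mem =
  nats :: "loc \<Rightarrow> nat"
  reals :: "loc \<Rightarrow> real"

datatype nexp =
    NConst nat
  | NVar nat nexp nexp
  | NAdd nexp nexp
  | NSub nexp nexp

datatype rexp =
    RConst nat
  | RVar nat nexp nexp
  | RAdd rexp rexp
  | RSub rexp rexp
  | RMul rexp rexp
  | RDiv rexp rexp

datatype bexp =
    NLess nexp nexp
  | RLess rexp rexp
  | BNot bexp
  | BAnd bexp bexp

primrec nval :: "nexp \<Rightarrow> mem \<Rightarrow> nat" where
  "nval (NConst k) s = k"
| "nval (NVar x a b) s = nats s (x, nval a s, nval b s)"
| "nval (NAdd a b) s = nval a s + nval b s"
| "nval (NSub a b) s = nval a s - nval b s"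

primrec rval :: "rexp \<Rightarrow> mem \<Rightarrow> real" where
  "rval (RConst k) s = real k"
| "rval (RVar x a b) s = reals s (x, nval a s, nval b s)"
| "rval (RAdd a b) s = rval a s + rval b s"
| "rval (RSub a b) s = rval a s - rval b s"
| "rval (RMul a b) s = rval a s * rval b s"
| "rval (RDiv a b) s = rval a s / rval b s"

primrec bval :: "bexp \<Rightarrow> mem \<Rightarrow> bool" where
  "bval (NLess a b) s = (nval a s < nval b s)"
| "bval (RLess a b) s = (rval a s < rval b s)"
| "bval (BNot b) s = (\<not> bval b s)"
| "bval (BAnd b c) s = (bval b s \<and> bval c s)"

datatype com =
    SKIP
  | NAssign nat nexp nexp nexp
  | RAssign nat nexp nexp rexp
  | Seq com com
  | Cond bexp com com
  | While bexp com

text \<open>\<open>exec c s t s'\<close>: started in memory \<open>s\<close>, the program \<open>c\<close> stops after \<open>t\<close> time units in memory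
  \<open>s'\<close>. Each assignment and each test counts one unit; the expressions in it have a size that depends
  on the program text only, so this agrees with a count of single operations up to a factor that is
  constant for each program.\<close>

inductive exec :: "com \<Rightarrow> mem \<Rightarrow> nat \<Rightarrow> mem \<Rightarrow> bool" where
  Skip: "exec SKIP s 1 s"
| NAssign: "exec (NAssign x a b e) s 1
              (s\<lparr>nats := (nats s)((x, nval a s, nval b s) := nval e s)\<rparr>)"
| RAssign: "exec (RAssign x a b e) s 1
              (s\<lparr>reals := (reals s)((x, nval a s, nval b s) := rval e s)\<rparr>)"
| Seq: "\<lbrakk> exec c s1 t1 s2; exec d s2 t2 s3 \<rbrakk> \<Longrightarrow> exec (Seq c d) s1 (t1 + t2) s3"
| CondTrue: "\<lbrakk> bval b s; exec c s t s' \<rbrakk> \<Longrightarrow> exec (Cond b c d) s (t + 1) s'"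
| CondFalse: "\<lbrakk> \<not> bval b s; exec d s t s' \<rbrakk> \<Longrightarrow> exec (Cond b c d) s (t + 1) s'"
| WhileFalse: "\<not> bval b s \<Longrightarrow> exec (While b c) s 1 s"
| WhileTrue: "\<lbrakk> bval b s1; exec c s1 t1 s2; exec (While b c) s2 t2 s3 \<rbrakk>
              \<Longrightarrow> exec (While b c) s1 (t1 + t2 + 1) s3"

text \<open>Initially, the scalars \<open>0\<close> and \<open>1\<close> of the natural memory hold \<open>n\<close> and \<open>m\<close>, and the real
  array \<open>0\<close> holds the values; all other entries are zero. At the end, entry \<open>(g, 0)\<close> of the natural
  array \<open>2\<close> is the owner of the good \<open>g\<close>.\<close>

definition input_mem :: "nat \<Rightarrow> nat \<Rightarrow> (nat \<Rightarrow> nat \<Rightarrow> real) \<Rightarrow> mem" where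
  "input_mem n m v =
     \<lparr> nats = (\<lambda>_. 0)((0, 0, 0) := n, (1, 0, 0) := m),
       reals = (\<lambda>(x, i, g). if x = 0 \<and> i \<in> {1..n} \<and> g \<in> {1..m} then v i g else 0) \<rparr>"

definition output_bundles :: "nat \<Rightarrow> mem \<Rightarrow> nat \<Rightarrow> nat set" where
  "output_bundles m s i = {g \<in> {1..m}. nats s (2, g, 0) = i}"

end

theory Submission
  imports Defs "HOL-Combinatorics.Permutations"
begin

text \<open>A good that is positive for agent \<open>i\<close> has a value for \<open>i\<close> within a factor \<open>sqrt \<gamma>\<close> of its base
  value. Goods are assigned in nearly decreasing order of base value: a good assigned in the else-if case
  is at least as large as all later goods, and the first good of a bundle is so up to the factor \<open>\<eta>\<close>.
  Let the source receive \<open>g\<close>, and let \<open>i\<close> be an agent whose bundle is nonempty. If the bundle of the source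
  without the removed good still contains a good that is positive for \<open>i\<close>, then this good and the removed one
  are worth at least \<open>\<gamma> x\<close> and \<open>\<gamma> \<eta> x\<close>, in some order, for \<open>x = v i g\<close>, and since \<open>i\<close> did not envy the source, the guarantee
  is \<open>\<gamma> (1 + \<eta>) / (1 + \<gamma>) = \<gamma> / \<eta>\<close>. Otherwise only \<open>g\<close> matters, and the choice of the first good of
  \<open>i\<close> from the goods near the top makes it worth at least \<open>\<gamma> / \<eta>\<close> times any later good. Each rotation
  decreases the number of envy edges.

  The machine has no square roots, so it compares squared base values. It finds an envy cycle by
  deleting agents that no remaining agent envies, and then following predecessors.\<close>

section \<open>Approximation guarantee\<close>

text \<open>The invariant has to survive rotations, which reassign bundles and ignore the order in
  which goods arrived. It is therefore split: what is known about the goods of a bundle refers to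
  the bundle alone and moves with it, while the lower bound on an agent's own bundle can only
  improve, since no agent ever loses value. Agents with an empty bundle, for whom no positive bound
  could hold, cause no trouble: a new singleton is empty once its good is removed, and a good given
  to a source is worth nothing to them. The program follows the transition system, so that its
  memory after each round represents a reachable configuration and the guarantee need not be proved
  again for it. Its running time reduces to counting iterations: one number \<open>N\<close> bounds
  every loop, and the time then follows from the program text.\<close>

locale fd_instance =
  fixes n m :: nat and v :: "nat \<Rightarrow> nat \<Rightarrow> real"
  assumes fair: "fair_division_instance n m v"
    and range_pos: "0 < range_param n m v" and range_le_1: "range_param n m v \<le> 1"
begin

abbreviation \<gamma> :: real where "\<gamma> \<equiv> range_param n m v"
abbreviation \<eta> :: real where "\<eta> \<equiv> eta \<gamma>"
abbreviation bv :: "nat \<Rightarrow> real" where "bv \<equiv> base_value n v"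

definition min_value :: "nat \<Rightarrow> real" where
  "min_value g = Min ((\<lambda>j. v j g) ` {j \<in> {1..n}. v j g > 0})"

lemma n_pos: "1 \<le> n" and v_nonneg: "i \<in> {1..n} \<Longrightarrow> g \<in> {1..m} \<Longrightarrow> 0 \<le> v i g"
  and ex_pos: "g \<in> {1..m} \<Longrightarrow> \<exists>i\<in>{1..n}. v i g > 0"
  using fair by (auto simp: fair_division_instance_def)

lemma m_pos: "1 \<le> m"
proof -
  have "pos_goods m v 1 \<noteq> {}" using fair n_pos by (auto simp: fair_division_instance_def)
  then show ?thesis by (auto simp: pos_goods_def)
qed

section \<open>The constant \<eta>\<close>

lemma eta_eq: "\<eta>\<^sup>2 + \<eta> = 1 + \<gamma>"
proof -
  have "(sqrt (5 + 4 * \<gamma>))\<^sup>2 = 5 + 4 * \<gamma>" using range_pos by simp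
  then show ?thesis unfolding eta_def by (simp add: power2_eq_square field_simps)
qed

lemma eta_pos: "0 < \<eta>"
  using range_pos by (simp add: eta_def)

lemma eta_le_1: "\<eta> \<le> 1"
proof -
  have "sqrt (5 + 4 * \<gamma>) \<le> sqrt 9" using range_le_1 by (intro real_sqrt_le_mono) simp
  then show ?thesis by (simp add: eta_def)
qed

lemma gamma_le_eta: "\<gamma> \<le> \<eta>"
proof -
  have "\<eta>\<^sup>2 \<le> 1" using eta_le_1 eta_pos by (simp add: power_le_one)
  with eta_eq show ?thesis by linarith
qed

lemma ratio_le_1: "\<gamma> / \<eta> \<le> 1"
  using eta_pos gamma_le_eta by simp

section \<open>Values of goods compared with base values\<close>

lemma value_le_max: "i \<in> {1..n} \<Longrightarrow> v i g \<le> max_value n v g"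
  by (auto simp: max_value_def intro!: Max_ge)

lemma min_value_le: "i \<in> {1..n} \<Longrightarrow> v i g > 0 \<Longrightarrow> min_value g \<le> v i g"
  by (auto simp: min_value_def intro!: Min_le)

lemma min_value_pos:
  assumes "g \<in> {1..m}" shows "0 < min_value g"
proof -
  have "min_value g \<in> (\<lambda>j. v j g) ` {j \<in> {1..n}. v j g > 0}"
    unfolding min_value_def using ex_pos[OF assms] by (intro Min_in) auto
  then show ?thesis by auto
qed

lemma max_value_pos: "g \<in> {1..m} \<Longrightarrow> 0 < max_value n v g"
  using ex_pos value_le_max by (meson less_le_trans)

lemma good_range_eq: "good_range n v g = min_value g / max_value n v g"
  by (simp add: good_range_def min_value_def)

lemma gamma_le: "g \<in> {1..m} \<Longrightarrow> \<gamma> \<le> min_value g / max_value n v g"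
  unfolding good_range_eq[symmetric] range_param_def by (intro Min_le) auto

text \<open>The base value is the geometric mean of the least positive and the largest value, hence
  equally far from both in ratio. Its square, the product under the root, is what the machine
  stores.\<close>

lemma base_value_eq:
  assumes "g \<in> {1..m}" shows "bv g = sqrt (min_value g * max_value n v g)"
proof -
  have "max_value n v g = sqrt ((max_value n v g)\<^sup>2)" using max_value_pos[OF assms] by simp
  then have "bv g = sqrt (good_range n v g * (max_value n v g)\<^sup>2)"
    by (simp add: base_value_def real_sqrt_mult)
  then show ?thesis using max_value_pos[OF assms]
    by (simp add: good_range_eq power2_eq_square)
qed

lemma base_value_pos: "g \<in> {1..m} \<Longrightarrow> 0 < bv g"
  using base_value_eq max_value_pos min_value_pos by simp

lemma value_ge_base:
  assumes "g \<in> {1..m}" "i \<in> {1..n}" "v i g > 0"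
  shows "sqrt \<gamma> * bv g \<le> v i g"
proof -
  have "sqrt \<gamma> * bv g \<le> sqrt (min_value g / max_value n v g) * bv g"
    using gamma_le[OF assms(1)] base_value_pos[OF assms(1)] by (intro mult_right_mono) auto
  also have "\<dots> = sqrt ((min_value g)\<^sup>2)"
    unfolding base_value_eq[OF assms(1)] real_sqrt_mult[symmetric]
    using max_value_pos[OF assms(1)] by (simp add: power2_eq_square)
  also have "\<dots> \<le> v i g" using min_value_pos[OF assms(1)] min_value_le assms by simp
  finally show ?thesis .
qed

lemma value_le_base:
  assumes "g \<in> {1..m}" "i \<in> {1..n}"
  shows "sqrt \<gamma> * v i g \<le> bv g"
proof -
  have "sqrt \<gamma> * v i g \<le> sqrt \<gamma> * max_value n v g"
    using value_le_max[OF assms(2)] range_pos by (intro mult_left_mono) auto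
  also have "\<dots> \<le> bv g"
    unfolding base_value_def good_range_eq
    using gamma_le[OF assms(1)] max_value_pos[OF assms(1)] by (intro mult_right_mono) auto
  finally show ?thesis .
qed

text \<open>Passing through base values costs a factor \<open>sqrt \<gamma>\<close> for each of the
  two goods. The factor \<open>c\<close> measures how well the goods are ordered: it is 1 or \<eta>
  for goods already in a bundle, and 1 / \<eta> for goods below the near-top threshold.\<close>

lemma value_ratio:
  assumes "g \<in> {1..m}" "h \<in> {1..m}" "i \<in> {1..n}" "v i g > 0" "0 \<le> c" "c * bv h \<le> bv g"
  shows "c * \<gamma> * v i h \<le> v i g"
proof -
  have "c * \<gamma> * v i h = c * (sqrt \<gamma> * (sqrt \<gamma> * v i h))"
    using range_pos by simp
  also have "\<dots> \<le> c * (sqrt \<gamma> * bv h)"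
    using assms value_le_base[of h i] range_pos by (intro mult_left_mono) auto
  also have "\<dots> = sqrt \<gamma> * (c * bv h)" by simp
  also have "\<dots> \<le> sqrt \<gamma> * bv g" using assms range_pos by (intro mult_left_mono) auto
  also have "\<dots> \<le> v i g" using assms value_ge_base by simp
  finally show ?thesis .
qed

text \<open>The extreme case \<open>y = \<gamma> x\<close>, \<open>w = \<gamma> \<eta> x\<close> is tight; this is where \<open>\<eta>\<close> comes from.\<close>

lemma ratio_bound:
  assumes "0 \<le> x" "(\<gamma> * x \<le> y \<and> \<eta> * \<gamma> * x \<le> w) \<or> (\<gamma> * x \<le> w \<and> \<eta> * \<gamma> * x \<le> y)"
  shows "\<gamma> / \<eta> * (y + x) \<le> y + w"
proof -
  \<comment> \<open>After clearing denominators, the difference of the two sides is (1 - \<gamma>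
    \<eta>) y + (1 + \<gamma>) w - \<gamma> (1 + \<eta>) x; this fact makes the coefficient of
    \<open>y\<close> nonnegative.\<close>
  have ge: "\<gamma> * \<eta> \<le> 1" using mult_le_one[of \<gamma> \<eta>] eta_le_1 eta_pos range_le_1 by simp
  have eq: "\<gamma> / \<eta> = \<gamma> * (1 + \<eta>) / (1 + \<gamma>)"
  proof -
    have "\<gamma> * (1 + \<gamma>) = \<gamma> * (1 + \<eta>) * \<eta>"
      unfolding eta_eq[symmetric] by (simp add: algebra_simps power2_eq_square)
    then show ?thesis using eta_pos range_pos by (simp add: frac_eq_eq)
  qed
  have "\<gamma> * (1 + \<eta>) * (y + x) \<le> (1 + \<gamma>) * (y + w)"
    using assms(2)
  proof
    assume a: "\<gamma> * x \<le> y \<and> \<eta> * \<gamma> * x \<le> w"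
    have "(1 - \<gamma> * \<eta>) * (\<gamma> * x) \<le> (1 - \<gamma> * \<eta>) * y"
      "(1 + \<gamma>) * (\<eta> * \<gamma> * x) \<le> (1 + \<gamma>) * w"
      using a ge range_pos by (auto intro!: mult_left_mono)
    then show ?thesis by (simp add: algebra_simps)
  next
    assume a: "\<gamma> * x \<le> w \<and> \<eta> * \<gamma> * x \<le> y"
    have "(1 - \<gamma> * \<eta>) * (\<eta> * \<gamma> * x) \<le> (1 - \<gamma> * \<eta>) * y"
      "(1 + \<gamma>) * (\<gamma> * x) \<le> (1 + \<gamma>) * w"
      using a ge range_pos by (auto intro!: mult_left_mono)
    \<comment> \<open>In this order of the two lower bounds the estimate has slack, namely this
      term.\<close>
    moreover have "0 \<le> \<gamma> * \<gamma> * x * (1 - \<eta> * \<eta>)"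
      using assms(1) range_pos eta_le_1 eta_pos mult_le_one[of \<eta> \<eta>] by simp
    ultimately show ?thesis by (simp add: algebra_simps)
  qed
  then show ?thesis unfolding eq using range_pos by (simp add: field_simps)
qed

lemma val_nonneg: "i \<in> {1..n} \<Longrightarrow> S \<subseteq> {1..m} \<Longrightarrow> 0 \<le> val v i S"
  unfolding val_def using v_nonneg by (intro sum_nonneg) auto

lemma val_mono: "i \<in> {1..n} \<Longrightarrow> S \<subseteq> T \<Longrightarrow> T \<subseteq> {1..m} \<Longrightarrow> val v i S \<le> val v i T"
  unfolding val_def using v_nonneg finite_subset[of T "{1..m}"]
  by (intro sum_mono2) auto

end

subsection \<open>Rotations along envy cycles\<close>

text \<open>Writing a rotation as composition with a permutation shows that the family of bundles is
  unchanged, so facts about single bundles carry over without looking at the cycle again.\<close>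

lemma rotation_permutation:
  assumes c: "simple_cycle (envy_graph v N A) c" and r: "rotate_bundles c A A'"
  obtains \<pi> where "\<pi> permutes N" "\<And>i. A' i = A (\<pi> i)"
    "\<And>i. i \<notin> N \<Longrightarrow> A' i = A i" "\<And>i. val v i (A i) \<le> val v i (A' i)"
    "\<exists>i\<in>N. val v i (A i) < val v i (A' i)"
proof -
  define K where "K = length c"
  have K: "0 < K" and dist: "distinct c"
    and E: "\<And>t. t < K \<Longrightarrow> (c ! t, c ! (Suc t mod K)) \<in> envy_graph v N A"
    using c by (auto simp: simple_cycle_def K_def)
  have rA: "\<And>t. t < K \<Longrightarrow> A' (c ! t) = A (c ! (Suc t mod K))" and rA': "\<And>i. i \<notin> set c \<Longrightarrow> A' i = A i"
    using r by (auto simp: rotate_bundles_def K_def)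
  have N: "set c \<subseteq> N"
    using E by (force simp: envy_graph_def in_set_conv_nth K_def)
  \<comment> \<open>The position of an agent in the list, unique because the cycle is
    simple.\<close>
  define \<sigma> where "\<sigma> i = (THE t. t < K \<and> c ! t = i)" for i
  have \<sigma>: "\<sigma> (c ! t) = t" if "t < K" for t
    unfolding \<sigma>_def using that dist by (intro the_equality) (auto simp: K_def nth_eq_iff_index_eq)
  define \<pi> where "\<pi> i = (if i \<in> set c then c ! (Suc (\<sigma> i) mod K) else i)" for i
  have \<pi>: "\<pi> (c ! t) = c ! (Suc t mod K)" if "t < K" for t
    using that \<sigma> by (simp add: \<pi>_def K_def)
  have "inj_on \<pi> (set c)"
  proof (rule inj_onI)
    fix x y assume "x \<in> set c" "y \<in> set c" "\<pi> x = \<pi> y"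
    then obtain t u where tu: "t < K" "u < K" "x = c ! t" "y = c ! u"
      by (auto simp: in_set_conv_nth K_def)
    then have "c ! (Suc t mod K) = c ! (Suc u mod K)" using \<open>\<pi> x = \<pi> y\<close> \<pi> by simp
    then have "Suc t mod K = Suc u mod K"
      using K dist by (simp add: nth_eq_iff_index_eq K_def)
    then have "t = u" using tu by (auto simp: mod_Suc split: if_splits)
    then show "x = y" using tu by simp
  qed
  moreover have "\<pi> ` set c \<subseteq> set c"
    using K by (auto simp: \<pi>_def K_def)
  ultimately have "bij_betw \<pi> (set c) (set c)"
    by (simp add: bij_betw_def endo_inj_surj)
  then have "\<pi> permutes set c"
    by (rule bij_imp_permutes) (simp add: \<pi>_def)
  then have perm: "\<pi> permutes N" using N by (rule permutes_subset)
  have A': "A' i = A (\<pi> i)" for i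
  proof (cases "i \<in> set c")
    case True
    then obtain t where "t < K" "i = c ! t" by (auto simp: in_set_conv_nth K_def)
    then show ?thesis using rA \<pi> by simp
  next
    case False
    then show ?thesis using rA' by (simp add: \<pi>_def)
  qed
  have strict: "val v i (A i) < val v i (A' i)" if "i \<in> set c" for i
    using that E rA by (force simp: in_set_conv_nth K_def envy_graph_def)
  have le: "val v i (A i) \<le> val v i (A' i)" for i
    using strict rA' by (cases "i \<in> set c") (auto intro: less_imp_le)
  have "c ! 0 \<in> set c" using K by (simp add: K_def)
  then have "\<exists>i\<in>N. val v i (A i) < val v i (A' i)" using strict N by blast
  then show ?thesis using that perm A' rA' N le by blast
qed

lemma finite_envy_graph: "finite N \<Longrightarrow> finite (envy_graph v N A)"
  by (rule finite_subset[of _ "N \<times> N"]) (auto simp: envy_graph_def)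

lemma card_envy_graph_le:
  assumes "N \<subseteq> {1..n}" shows "card (envy_graph v N A) \<le> n * n"
proof -
  have "card (envy_graph v N A) \<le> card ({1..n} \<times> {1..n})"
    using assms by (intro card_mono) (auto simp: envy_graph_def)
  then show ?thesis by (simp add: card_cartesian_product)
qed

text \<open>The map (i, j) \<mapsto> (i, \<pi> j) sends new edges to old ones, because own values do
  not fall and the bundle of \<open>j\<close> formerly belonged to \<open>\<pi> j\<close>. For
  \<open>k\<close> on the cycle the old edge (k, \<pi> k) is missed: its preimage would be a
  self-loop, and nobody envies itself.\<close>

lemma rotation_decreases_envy:
  assumes "finite N" "simple_cycle (envy_graph v N A) c" "rotate_bundles c A A'"
  shows "card (envy_graph v N A') < card (envy_graph v N A)"
proof -
  from rotation_permutation[OF assms(2,3)] obtain \<pi> where \<pi>: "\<pi> permutes N" "\<And>i. A' i = A (\<pi> i)"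
    "\<And>i. val v i (A i) \<le> val v i (A' i)" "\<exists>i\<in>N. val v i (A i) < val v i (A' i)" by metis
  then obtain k where k: "k \<in> N" "val v k (A k) < val v k (A' k)" by blast
  let ?F = "\<lambda>(i, j). (i, \<pi> j)"
  have inj: "inj_on ?F (envy_graph v N A')"
    using permutes_inj[OF \<pi>(1)] by (auto simp: inj_on_def)
  have in_N: "\<pi> j \<in> N" if "j \<in> N" for j using that permutes_in_image[OF \<pi>(1)] by blast
  have sub: "?F ` envy_graph v N A' \<subseteq> envy_graph v N A"
    using \<pi>(2) in_N le_less_trans[OF \<pi>(3)] by (auto simp: envy_graph_def)
  have "(k, \<pi> k) \<in> envy_graph v N A" using k \<pi>(2) in_N by (auto simp: envy_graph_def)
  moreover have "(k, \<pi> k) \<notin> ?F ` envy_graph v N A'"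
    using permutes_inj[OF \<pi>(1)] by (auto simp: envy_graph_def dest: injD)
  ultimately have "?F ` envy_graph v N A' \<subset> envy_graph v N A" using sub by blast
  then have "card (?F ` envy_graph v N A') < card (envy_graph v N A)"
    using finite_envy_graph[OF assms(1)] by (rule psubset_card_mono[rotated])
  then show ?thesis using inj by (simp add: card_image)
qed

text \<open>A walk of \<open>n\<close> steps back from \<open>x\<close> must have entered a cycle,
  since \<open>R\<close> has at most \<open>n\<close> elements. The set of the cycle is also given
  by \<open>n\<close> iterates, because the machine walks that far without knowing the cycle
  length.\<close>

lemma predecessor_cycle:
  assumes R: "finite R" "card R \<le> n" "x \<in> R"
    and p: "\<And>z. z \<in> R \<Longrightarrow> p z \<in> R" "\<And>z. z \<in> R \<Longrightarrow> (p z, z) \<in> E"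
  defines "y \<equiv> (p ^^ n) x"
  obtains c where "simple_cycle E c" "set c = (\<lambda>k. (p ^^ k) y) ` {..<n}" "set c \<subseteq> R"
    "\<And>t. t < length c \<Longrightarrow> p (c ! ((t + 1) mod length c)) = c ! t"
proof -
  have in_R: "(p ^^ k) z \<in> R" if "z \<in> R" for k z using that p(1) by (induction k) auto
  have y: "y \<in> R" unfolding y_def using R in_R by blast
  \<comment> \<open>Pigeonhole: these are \<open>n + 1\<close> iterates in a set of at most
    \<open>n\<close> elements.\<close>
  have "\<not> inj_on (\<lambda>k. (p ^^ k) x) {..n}"
  proof
    assume "inj_on (\<lambda>k. (p ^^ k) x) {..n}"
    then have "card {..n} \<le> card R" using in_R R by (intro card_inj_on_le[of _ _ R]) auto
    then show False using R by simp
  qed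
  then obtain i j where ij: "i < j" "j \<le> n" "(p ^^ i) x = (p ^^ j) x"
  proof -
    obtain a b where ab: "a \<le> n" "b \<le> n" "(p ^^ a) x = (p ^^ b) x" "a \<noteq> b"
      using \<open>\<not> inj_on _ _\<close> by (auto simp: inj_on_def)
    then consider "a < b" | "b < a" by linarith
    then show ?thesis using ab that by cases auto
  qed
  \<comment> \<open>The iterate \<open>(p ^^ i) x\<close> is already periodic, and \<open>y\<close>
    lies \<open>n - i\<close> steps further along the same orbit.\<close>
  have "(p ^^ (j - i)) y = (p ^^ (j - i + n)) x" by (simp add: y_def funpow_add)
  also have "j - i + n = (n - i) + j" using ij by simp
  also have "(p ^^ ((n - i) + j)) x = (p ^^ (n - i)) ((p ^^ j) x)" by (simp only: funpow_add comp_apply)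
  also have "\<dots> = (p ^^ (n - i + i)) x" unfolding funpow_add comp_apply ij(3) ..
  also have "\<dots> = y" using ij by (simp add: y_def)
  finally have ex: "\<exists>k>0. (p ^^ k) y = y" using ij by (intro exI[of _ "j - i"]) simp
  define K where "K = (LEAST k. k > 0 \<and> (p ^^ k) y = y)"
  have K: "K > 0" "(p ^^ K) y = y" using LeastI_ex[OF ex] by (auto simp: K_def)
  have minK: "(p ^^ k) y \<noteq> y" if "0 < k" "k < K" for k
    using not_less_Least[of k "\<lambda>k. k > 0 \<and> (p ^^ k) y = y"] that by (auto simp: K_def)
  have neq: "(p ^^ a) y \<noteq> (p ^^ b) y" if "a < b" "b < K" for a b
  proof
    assume eq: "(p ^^ a) y = (p ^^ b) y"
    have "(p ^^ (K - b + a)) y = (p ^^ (K - b)) ((p ^^ a) y)" by (simp add: funpow_add)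
    also have "\<dots> = (p ^^ (K - b + b)) y" unfolding eq by (simp add: funpow_add)
    also have "\<dots> = y" using that K by simp
    finally have "(p ^^ (K - b + a)) y = y" .
    moreover have "(p ^^ (K - b + a)) y \<noteq> y" using that by (intro minK) linarith+
    ultimately show False by contradiction
  qed
  have inj: "inj_on (\<lambda>k. (p ^^ k) y) {..<K}"
  proof (rule inj_onI)
    fix a b assume "a \<in> {..<K}" "b \<in> {..<K}" "(p ^^ a) y = (p ^^ b) y"
    then show "a = b" using neq[of a b] neq[of b a] by (cases a b rule: linorder_cases) auto
  qed
  have "card {..<K} \<le> card R" using inj in_R y R by (intro card_inj_on_le[OF inj]) auto
  then have Kn: "K \<le> n" using R by simp
  have modK: "(p ^^ k) y = (p ^^ (k mod K)) y" for k
    using K(2) by (simp add: funpow_mod_eq)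
  \<comment> \<open>The orbit is listed backwards, as \<open>p\<close> runs against the
    edges.\<close>
  define c where "c = map (\<lambda>t. (p ^^ (K - 1 - t)) y) [0..<K]"
  have len: "length c = K" by (simp add: c_def)
  have cn: "c ! t = (p ^^ (K - 1 - t)) y" if "t < K" for t using that by (simp add: c_def)
  have pred_c: "p (c ! ((t + 1) mod K)) = c ! t" if "t < K" for t
  proof (cases "t + 1 = K")
    case True
    then have "p (c ! ((t + 1) mod K)) = p ((p ^^ (K - 1)) y)" using K by (simp add: cn)
    also have "\<dots> = (p ^^ Suc (K - 1)) y" by simp
    also have "Suc (K - 1) = K" using K by simp
    finally show ?thesis using True K(2) that by (simp add: cn[OF that])
  next
    case False
    then have "t + 1 < K" using that by simp
    then have "p (c ! ((t + 1) mod K)) = p ((p ^^ (K - 1 - (t + 1))) y)" by (simp add: cn)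
    also have "\<dots> = (p ^^ Suc (K - 1 - (t + 1))) y" by simp
    also have "Suc (K - 1 - (t + 1)) = K - 1 - t" using \<open>t + 1 < K\<close> by simp
    finally show ?thesis using that by (simp add: cn)
  qed
  have set: "set c = (\<lambda>k. (p ^^ k) y) ` {..<K}"
  proof -
    have "(\<lambda>t. K - 1 - t) ` {..<K} = {..<K}"
    proof safe
      fix k assume "k < K"
      then show "k \<in> (\<lambda>t. K - 1 - t) ` {..<K}" by (intro image_eqI[of _ _ "K - 1 - k"]) auto
    qed (use K in auto)
    then have "(\<lambda>k. (p ^^ k) y) ` {..<K} = (\<lambda>k. (p ^^ k) y) ` (\<lambda>t. K - 1 - t) ` {..<K}"
      by simp
    then show ?thesis by (simp add: c_def atLeast0LessThan image_image)
  qed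
  have "distinct c"
    by (rule card_distinct) (simp add: set len card_image[OF inj])
  moreover have "(c ! t, c ! ((t + 1) mod K)) \<in> E" if "t < K" for t
  proof -
    have "c ! ((t + 1) mod K) \<in> R" using K in_R[OF y] by (simp add: cn)
    then show ?thesis using p(2)[of "c ! ((t + 1) mod K)"] pred_c[OF that] by simp
  qed
  ultimately have "simple_cycle E c" using K len by (auto simp: simple_cycle_def)
  moreover have "set c = (\<lambda>k. (p ^^ k) y) ` {..<n}"
  proof -
    have "(p ^^ k) y \<in> (\<lambda>k. (p ^^ k) y) ` {..<K}" for k
      using modK[of k] K by (intro image_eqI[of _ _ "k mod K"]) auto
    then show ?thesis unfolding set using Kn by force
  qed
  moreover have "set c \<subseteq> R" using in_R[OF y] by (auto simp: set)
  ultimately show ?thesis using that pred_c len by simp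
qed

section \<open>Cycles and sources in finite graphs\<close>

lemma on_cycle_predecessor:
  assumes "(x, x) \<in> E\<^sup>+" shows "\<exists>z. (z, z) \<in> E\<^sup>+ \<and> (z, x) \<in> E"
proof -
  have "(x, x) \<in> E\<^sup>* O E" using assms unfolding trancl_unfold_right[symmetric] by simp
  then obtain z where "(x, z) \<in> E\<^sup>*" "(z, x) \<in> E" by auto
  then have "(z, z) \<in> E\<^sup>+" by simp
  then show ?thesis using \<open>(z, x) \<in> E\<close> by blast
qed

text \<open>The vertices on closed walks form a set in which every member has a predecessor. This is
  the certificate the machine obtains when its deletions leave no agent.\<close>

lemma acyclicI_no_core:
  assumes "E \<subseteq> N \<times> N" "\<And>D. D \<subseteq> N \<Longrightarrow> \<forall>j\<in>D. \<exists>i\<in>D. (i, j) \<in> E \<Longrightarrow> D = {}"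
  shows "acyclic E"
proof -
  have "{x. (x, x) \<in> E\<^sup>+} \<subseteq> N"
    using trancl_subset_Sigma[OF assms(1)] by blast
  moreover have "\<forall>j\<in>{x. (x, x) \<in> E\<^sup>+}. \<exists>i\<in>{x. (x, x) \<in> E\<^sup>+}. (i, j) \<in> E"
    using on_cycle_predecessor[of _ E] by simp
  ultimately have "{x. (x, x) \<in> E\<^sup>+} = {}" by (rule assms(2))
  then show ?thesis by (simp add: acyclic_def)
qed

lemma not_acyclic_simple_cycle:
  assumes "finite E" "\<not> acyclic E"
  obtains c where "simple_cycle E c"
proof -
  define R where "R = {x. (x, x) \<in> E\<^sup>+}"
  have "R \<subseteq> Range E" by (auto simp: R_def elim: tranclE)
  then have fin: "finite R" using assms(1) by (meson finite_Range finite_subset)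
  have "\<exists>z. z \<in> R \<and> (z, x) \<in> E" if "x \<in> R" for x
    using on_cycle_predecessor[of x E] that by (simp add: R_def)
  then obtain p where p: "\<And>x. x \<in> R \<Longrightarrow> p x \<in> R \<and> (p x, x) \<in> E" by metis
  obtain x where "x \<in> R" using assms(2) by (auto simp: R_def acyclic_def)
  show ?thesis
    by (rule predecessor_cycle[OF fin order_refl \<open>x \<in> R\<close>, of p E]) (use p that in auto)
qed

lemma ex_rotate_bundles:
  assumes "distinct c" shows "\<exists>A'. rotate_bundles c A A'"
proof -
  define A' where "A' i = (if i \<in> set c then A (c ! (((THE t. t < length c \<and> c ! t = i) + 1) mod length c))
    else A i)" for i
  have "(THE u. u < length c \<and> c ! u = c ! t) = t" if "t < length c" for t
    using that assms by (intro the_equality) (auto simp: nth_eq_iff_index_eq)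
  then have "rotate_bundles c A A'" by (simp add: rotate_bundles_def A'_def)
  then show ?thesis by blast
qed

lemma acyclic_source:
  assumes "acyclic E" "finite E" "N \<noteq> {}"
  obtains s where "source N E s"
proof -
  have "wf E" using assms by (simp add: finite_acyclic_wf)
  then show ?thesis using assms(3) that unfolding source_def by (metis ex_in_conv wfE_min)
qed

lemma disjoint_family_on_update:
  assumes "disjoint_family_on A S" "i \<in> S" "\<And>j. j \<in> S \<Longrightarrow> x \<notin> A j" "B \<subseteq> insert x (A i)"
  shows "disjoint_family_on (A(i := B)) S"
  unfolding disjoint_family_on_def
proof (intro ballI impI)
  fix a b assume ab: "a \<in> S" "b \<in> S" "a \<noteq> b"
  then have "A a \<inter> A b = {}" "x \<notin> A a" "x \<notin> A b"
    using assms(1,3) by (auto simp: disjoint_family_on_def)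
  then show "(A(i := B)) a \<inter> (A(i := B)) b = {}"
    using assms(4) ab by (cases "a = i"; cases "b = i") auto
qed

context fd_instance
begin

subsection \<open>Invariant of the algorithm\<close>

text \<open>No owner is mentioned, so the property travels with the bundle. The exception
  \<open>f\<close> stands for the good taken in the if-case, which was only near the top; the other
  goods of the bundle had maximal base value when added.\<close>

definition bundle_inv :: "nat set \<Rightarrow> nat set \<Rightarrow> bool" where
  "bundle_inv U B \<longleftrightarrow> (\<forall>g\<in>B. \<forall>h\<in>U. \<eta> * bv h \<le> bv g) \<and>
     (\<exists>f. \<forall>g\<in>B - {f}. \<forall>h\<in>U. bv h \<le> bv g)"

text \<open>The bound comparing \<open>v i h\<close> with the own bundle is for a later step: when
  \<open>i\<close> values nothing in the source's bundle except the removed good and the newly added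
  one, only that single new good has to be matched.\<close>

definition state_inv :: "(nat \<Rightarrow> nat set) \<Rightarrow> nat set \<Rightarrow> nat set \<Rightarrow> bool" where
  "state_inv A U Z \<longleftrightarrow> Z \<subseteq> {1..n} \<and> U \<subseteq> {1..m} \<and> disjoint_family_on A {1..n} \<and>
     (\<Union>i\<in>{1..n}. A i) = {1..m} - U \<and> (\<forall>i\<in>Z. A i = {}) \<and>
     approx_efx (\<gamma> / \<eta>) n m v A \<and>
     (\<forall>i\<in>{1..n} - Z. \<forall>h\<in>U. \<gamma> / \<eta> * v i h \<le> val v i (A i)) \<and>
     (\<forall>i\<in>{1..n}. bundle_inv U (A i))"

text \<open>What else_case established about the selected good is remembered in
  \<open>Resolve\<close>, since it is needed only at the assignment, after any number of
  rotations.\<close>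

fun config_inv :: "config \<Rightarrow> bool" where
  "config_inv (Loop A U Z) = state_inv A U Z"
| "config_inv (Resolve A U Z g) = (state_inv A U Z \<and> is_arg_max bv (\<lambda>h. h \<in> U) g \<and> (\<forall>i\<in>Z. v i g = 0))"

lemma state_invD:
  assumes "state_inv A U Z"
  shows "Z \<subseteq> {1..n}" "U \<subseteq> {1..m}" "disjoint_family_on A {1..n}"
    "(\<Union>i\<in>{1..n}. A i) = {1..m} - U" "\<And>i. i \<in> Z \<Longrightarrow> A i = {}"
    "approx_efx (\<gamma> / \<eta>) n m v A"
    "\<And>i h. i \<in> {1..n} - Z \<Longrightarrow> h \<in> U \<Longrightarrow> \<gamma> / \<eta> * v i h \<le> val v i (A i)"
    "\<And>i. i \<in> {1..n} \<Longrightarrow> bundle_inv U (A i)"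
    "\<And>i. i \<in> {1..n} \<Longrightarrow> A i \<subseteq> {1..m} - U" "\<And>i. i \<in> {1..n} \<Longrightarrow> A i \<subseteq> {1..m}"
  using assms unfolding state_inv_def by blast+

lemma bundle_inv_mono: "bundle_inv U B \<Longrightarrow> U' \<subseteq> U \<Longrightarrow> bundle_inv U' B"
  unfolding bundle_inv_def by blast

lemma arg_max_ge: "is_arg_max f P x \<Longrightarrow> P y \<Longrightarrow> f y \<le> (f x :: real)"
  by (auto simp: is_arg_max_def not_less)

lemma Max_arg_max:
  assumes "finite U" "is_arg_max f (\<lambda>h. h \<in> U) g"
  shows "Max (f ` U) = (f g :: real)"
  using assms by (intro Max_eqI) (auto simp: is_arg_max_def not_less)

lemma inv_init: "state_inv (\<lambda>_. {}) {1..m} {1..n}"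
  by (auto simp: state_inv_def disjoint_family_on_def approx_efx_def bundle_inv_def)

text \<open>A singleton causes no envy once its good is removed, so the only new obligation is that
  the chosen good of \<open>i\<close> compares well with everything still unassigned.\<close>

lemma inv_if_case:
  assumes inv: "state_inv A U Z" and g: "is_arg_max bv (\<lambda>h. h \<in> U) g" and i: "i \<in> Z" "v i g > 0"
    and f: "is_arg_max (v i) (\<lambda>h. h \<in> near_top n m v U) f"
  shows "state_inv (A(i := {f})) (U - {f}) (Z - {i})"
proof -
  note I = state_invD[OF inv]
  have g_U: "g \<in> U" using g by (simp add: is_arg_max_def)
  have i_n: "i \<in> {1..n}" using i I(1) by blast
  have fin: "finite U" using I(2) by (rule finite_subset) simp
  have top: "h \<in> near_top n m v U \<longleftrightarrow> h \<in> U \<and> \<eta> * bv g \<le> bv h" for h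
    by (simp add: near_top_def Max_arg_max[OF fin g])
  have f_U: "f \<in> U" "\<eta> * bv g \<le> bv f"
    using f top by (auto simp: is_arg_max_def)
  have vf: "v i h \<le> v i f" if "h \<in> U" "\<eta> * bv g \<le> bv h" for h
    using arg_max_ge[OF f] top that by blast
  have bvg: "bv h \<le> bv g" if "h \<in> U" for h using arg_max_ge[OF g] that by blast
  have bvg0: "0 < bv g" using base_value_pos g_U I(2) by blast
  \<comment> \<open>A good above the threshold is beaten by \<open>f\<close> directly. A good below
    it is smaller than \<open>g\<close> by a factor \<eta> in base value, and \<open>g\<close>
    itself was a candidate for \<open>f\<close>.\<close>
  have third: "\<gamma> / \<eta> * v i h \<le> v i f" if h: "h \<in> U" for h
  proof (cases "\<eta> * bv g \<le> bv h")
    case True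
    then have "v i h \<le> v i f" using vf h by blast
    moreover have "\<gamma> / \<eta> * v i h \<le> 1 * v i h"
      using ratio_le_1 v_nonneg i_n h I(2) by (intro mult_right_mono) auto
    ultimately show ?thesis by simp
  next
    case False
    then have "1 / \<eta> * bv h \<le> bv g" using eta_pos by (simp add: field_simps)
    then have "1 / \<eta> * \<gamma> * v i h \<le> v i g"
      using g_U h I(2) i i_n eta_pos by (intro value_ratio) auto
    moreover have "\<eta> * bv g \<le> 1 * bv g" using eta_le_1 bvg0 by (intro mult_right_mono) auto
    then have "v i g \<le> v i f" using g_U vf by simp
    ultimately show ?thesis by simp
  qed
  show ?thesis
    unfolding state_inv_def
  proof (intro conjI ballI)
    show "Z - {i} \<subseteq> {1..n}" "U - {f} \<subseteq> {1..m}" using I(1,2) by auto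
    show "disjoint_family_on (A(i := {f})) {1..n}"
      using I(3) i_n I(9) f_U by (intro disjoint_family_on_update[where x = f]) auto
    show "(\<Union>j\<in>{1..n}. (A(i := {f})) j) = {1..m} - (U - {f})"
    proof -
      have "(\<Union>j\<in>{1..n}. (A(i := {f})) j) = {f} \<union> (\<Union>j\<in>{1..n}. A j)"
        using i_n I(5)[OF i(1)] by (auto split: if_splits)
      then show ?thesis using I(4) f_U I(2) by auto
    qed
    show "(A(i := {f})) j = {}" if "j \<in> Z - {i}" for j using that I(5) by simp
    show "approx_efx (\<gamma> / \<eta>) n m v (A(i := {f}))"
      unfolding approx_efx_def
    proof (intro ballI)
      fix a b h assume a: "a \<in> {1..n}" and b: "b \<in> {1..n}" and h: "h \<in> (A(i := {f})) b \<inter> pos_goods m v a"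
      \<comment> \<open>The bundle \<open>A i\<close> was empty, so overwriting it loses
        nothing.\<close>
      have le: "val v a (A a) \<le> val v a ((A(i := {f})) a)"
        using I(5)[OF i(1)] v_nonneg a f_U I(2) by (auto simp: val_def)
      show "\<gamma> / \<eta> * val v a ((A(i := {f})) b - {h}) \<le> val v a ((A(i := {f})) a)"
      proof (cases "b = i")
        case True
        then have "(A(i := {f})) b - {h} = {}" using h by auto
        then have "val v a ((A(i := {f})) b - {h}) = 0" by (simp only: val_def sum.empty)
        then show ?thesis using le val_nonneg[OF a I(10)[OF a]] by (simp only: mult_zero_right)
      next
        case False
        then have "\<gamma> / \<eta> * val v a ((A(i := {f})) b - {h}) \<le> val v a (A a)"
          using h I(6) a b by (auto simp: approx_efx_def)
        then show ?thesis using le by simp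
      qed
    qed
    show "\<gamma> / \<eta> * v j h \<le> val v j ((A(i := {f})) j)" if "j \<in> {1..n} - (Z - {i})" "h \<in> U - {f}" for j h
      using that I(7) third by (cases "j = i") (auto simp: val_def)
    show "bundle_inv (U - {f}) ((A(i := {f})) j)" if "j \<in> {1..n}" for j
    proof (cases "j = i")
      case True
      have "\<eta> * bv h \<le> bv f" if "h \<in> U" for h
      proof -
        have "\<eta> * bv h \<le> \<eta> * bv g" using bvg[OF that] eta_pos by simp
        then show ?thesis using f_U by linarith
      qed
      then show ?thesis using True by (auto simp: bundle_inv_def)
    next
      case False
      then show ?thesis using I(8)[OF that] by (auto intro: bundle_inv_mono)
    qed
  qed
qed

text \<open>Of the two distinct goods \<open>h\<close> and \<open>k\<close> at most one is the
  exceptional good of the bundle, so at least one of them satisfies the bound without the factor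
  \<eta>.\<close>

lemma two_goods_bound:
  assumes inv: "state_inv A U Z" and g: "g \<in> U" and i: "i \<in> {1..n}" and s: "s \<in> {1..n}"
    and h: "h \<in> A s" "v i h > 0" and k: "k \<in> A s - {h}" "v i k > 0"
  shows "\<gamma> / \<eta> * (val v i (A s - {h}) + v i g) \<le> val v i (A s)"
proof -
  note I = state_invD[OF inv]
  have fin: "finite (A s)" using I(10)[OF s] by (rule finite_subset) simp
  have ms: "g \<in> {1..m}" "h \<in> {1..m}" "k \<in> {1..m}" using g h k I(2) I(10)[OF s] by blast+
  have "val v i {k} \<le> val v i (A s - {h})"
    using k I(10)[OF s] by (intro val_mono i) auto
  then have y: "v i k \<le> val v i (A s - {h})" by (simp add: val_def)
  obtain f where f: "\<And>x. x \<in> A s - {f} \<Longrightarrow> bv g \<le> bv x" and e: "\<And>x. x \<in> A s \<Longrightarrow> \<eta> * bv g \<le> bv x"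
    using I(8)[OF s] g unfolding bundle_inv_def by blast
  have eta_r: "\<eta> * \<gamma> * v i g \<le> v i x" if "x \<in> {1..m}" "x \<in> A s" "v i x > 0" for x
    using that e ms i eta_pos by (intro value_ratio) auto
  have one_r: "\<gamma> * v i g \<le> v i x" if "x \<in> {1..m}" "x \<in> A s - {f}" "v i x > 0" for x
    using value_ratio[of x g i 1] that f ms i by auto
  have "(\<gamma> * v i g \<le> val v i (A s - {h}) \<and> \<eta> * \<gamma> * v i g \<le> v i h) \<or>
    (\<gamma> * v i g \<le> v i h \<and> \<eta> * \<gamma> * v i g \<le> val v i (A s - {h}))"
  proof (cases "h = f")
    case True
    then have "\<gamma> * v i g \<le> v i k" using one_r ms k by auto
    then show ?thesis using y eta_r[of h] ms h by auto
  next
    case False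
    then have "\<gamma> * v i g \<le> v i h" using one_r ms h by auto
    then show ?thesis using y eta_r[of k] ms k by auto
  qed
  \<comment> \<open>Here \<open>x\<close> is the value of the added good, \<open>w\<close> that of
    the removed one, and \<open>y\<close> that of the remaining bundle, which is at least the value
    of \<open>k\<close>.\<close>
  then have "\<gamma> / \<eta> * (val v i (A s - {h}) + v i g) \<le> val v i (A s - {h}) + v i h"
    using v_nonneg[OF i ms(1)] by (rule ratio_bound[rotated])
  also have "\<dots> = val v i (A s)" unfolding val_def using fin h by (simp add: sum.remove[of "A s" h])
  finally show ?thesis .
qed

lemma inv_assign:
  assumes inv: "state_inv A U Z" and g: "is_arg_max bv (\<lambda>h. h \<in> U) g" "\<forall>i\<in>Z. v i g = 0"
    and s: "source ({1..n} - Z) (envy_graph v ({1..n} - Z) A) s"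
  shows "state_inv (A(s := insert g (A s))) (U - {g}) Z"
proof -
  note I = state_invD[OF inv]
  let ?A = "A(s := insert g (A s))"
  have g_U: "g \<in> U" using g by (simp add: is_arg_max_def)
  have g_m: "g \<in> {1..m}" using g_U I(2) by blast
  have s_n: "s \<in> {1..n}" "s \<notin> Z" using s by (auto simp: source_def)
  have no_envy: "val v i (A s) \<le> val v i (A i)" if "i \<in> {1..n} - Z" for i
    using s that by (auto simp: source_def envy_graph_def not_less)
  have bvg: "bv h \<le> bv g" if "h \<in> U" for h using arg_max_ge[OF g(1)] that by blast
  have g_new: "g \<notin> A s" using I(9)[OF s_n(1)] g_U by blast
  have fin: "finite (A s)" using I(10)[OF s_n(1)] by (rule finite_subset) simp
  have le: "val v i (A i) \<le> val v i (?A i)" if "i \<in> {1..n}" for i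
    using I(10)[OF that] g_m by (intro val_mono[OF that]) auto
  show ?thesis
    unfolding state_inv_def
  proof (intro conjI ballI)
    show "Z \<subseteq> {1..n}" "U - {g} \<subseteq> {1..m}" using I(1,2) by auto
    show "disjoint_family_on ?A {1..n}"
      using I(3) s_n(1) I(9) g_U by (intro disjoint_family_on_update[where x = g]) auto
    show "(\<Union>j\<in>{1..n}. ?A j) = {1..m} - (U - {g})"
    proof -
      have "(\<Union>j\<in>{1..n}. ?A j) = {g} \<union> (\<Union>j\<in>{1..n}. A j)"
        using s_n by (auto split: if_splits)
      then show ?thesis using I(4) g_m by auto
    qed
    show "?A j = {}" if "j \<in> Z" for j using that I(5) s_n by auto
    show "\<gamma> / \<eta> * v j h \<le> val v j (?A j)" if "j \<in> {1..n} - Z" "h \<in> U - {g}" for j h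
      using le[of j] I(7)[of j h] that by auto
    show "bundle_inv (U - {g}) (?A j)" if "j \<in> {1..n}" for j
    proof (cases "j = s")
      case True
      have "bundle_inv U (insert g (A s))"
      proof -
        have "\<eta> * bv h \<le> bv g" if "h \<in> U" for h
        proof -
          have "\<eta> * bv h \<le> 1 * bv h"
            using eta_le_1 base_value_pos[of h] that I(2) by (intro mult_right_mono) auto
          then show ?thesis using bvg[OF that] by linarith
        qed
        moreover obtain f where "\<forall>x\<in>A s - {f}. \<forall>h\<in>U. bv h \<le> bv x"
          using I(8)[OF s_n(1)] by (auto simp: bundle_inv_def)
        then have "\<forall>x\<in>insert g (A s) - {f}. \<forall>h\<in>U. bv h \<le> bv x" using bvg by blast
        ultimately show ?thesis using I(8)[OF s_n(1)] unfolding bundle_inv_def by blast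
      qed
      then show ?thesis using True by (auto intro: bundle_inv_mono)
    next
      case False
      then show ?thesis using I(8)[OF that] by (auto intro: bundle_inv_mono)
    qed
    show "approx_efx (\<gamma> / \<eta>) n m v ?A"
      unfolding approx_efx_def
    proof (intro ballI)
      fix i j h assume i: "i \<in> {1..n}" and j: "j \<in> {1..n}" and h: "h \<in> ?A j \<inter> pos_goods m v i"
      have hi: "v i h > 0" using h by (simp add: pos_goods_def)
      have efx: "\<gamma> / \<eta> * val v i (A j - {h}) \<le> val v i (?A i)" if "h \<in> A j"
      proof -
        have "\<gamma> / \<eta> * val v i (A j - {h}) \<le> val v i (A i)"
          using I(6) i j h that unfolding approx_efx_def by blast
        then show ?thesis using le[OF i] by linarith
      qed
      show "\<gamma> / \<eta> * val v i (?A j - {h}) \<le> val v i (?A i)"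
      proof (cases "j = s")
        case False
        then show ?thesis using efx h by simp
      next
        case j: True
        show ?thesis
        \<comment> \<open>Agents in \<open>Z\<close> fall under the first case: the new good adds
          nothing for them and is not the removed one, which is positive for
          \<open>i\<close>.\<close>
        proof (cases "v i g = 0")
          case True
          then have "h \<in> A s" "h \<noteq> g" using h hi j by auto
          moreover have "val v i (?A s - {h}) = val v i (A s - {h})"
            using fin g_new True \<open>h \<noteq> g\<close> by (simp add: val_def insert_Diff_if)
          ultimately show ?thesis using efx j by simp
        next
          case False
          then have iZ: "i \<in> {1..n} - Z" using g(2) i by blast
          show ?thesis
          \<comment> \<open>Removing \<open>g\<close> restores the old bundle of the source, which
            \<open>i\<close> does not envy.\<close>
          proof (cases "h = g")
            case True
            have "\<gamma> / \<eta> * val v i (A s) \<le> 1 * val v i (A s)"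
              using ratio_le_1 val_nonneg[OF i I(10)[OF s_n(1)]] by (rule mult_right_mono)
            also have "\<dots> \<le> val v i (?A i)" using no_envy[OF iZ] le[OF i] by simp
            finally show ?thesis using True j g_new by simp
          next
            case False
            then have hA: "h \<in> A s" using h j by simp
            have split: "val v i (?A j - {h}) = val v i (A s - {h}) + v i g"
              using fin g_new False j by (simp add: val_def insert_Diff_if)
            show ?thesis
            \<comment> \<open>Without a further positive good, everything but \<open>g\<close> is
              worthless to \<open>i\<close>, and the bound on single unassigned goods in
              \<open>state_inv\<close> applies to \<open>g\<close>.\<close>
            proof (cases "\<exists>k\<in>A s - {h}. v i k > 0")
              case True
              then obtain k where "k \<in> A s - {h}" "v i k > 0" by blast
              from two_goods_bound[OF inv g_U i s_n(1) hA hi this] show ?thesis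
                unfolding split using no_envy[OF iZ] le[OF i] by linarith
            next
              case False
              then have "v i k = 0" if "k \<in> A s - {h}" for k
                using v_nonneg[OF i, of k] that I(10)[OF s_n(1)] by force
              then have "val v i (A s - {h}) = 0" by (simp add: val_def)
              then show ?thesis unfolding split
                using I(7)[OF iZ g_U] le[OF i] by simp
            qed
          qed
        qed
      qed
    qed
  qed
qed

text \<open>Each condition compares an agent's own value with some bundle or with some unassigned
  good, or concerns a bundle alone. Rotation permutes the bundles, raises own values or leaves them
  equal, and does not touch the unassigned goods.\<close>

lemma inv_rotate:
  assumes inv: "state_inv A U Z"
    and c: "simple_cycle (envy_graph v ({1..n} - Z) A) c" "rotate_bundles c A A'"
  shows "state_inv A' U Z"
proof -
  note I = state_invD[OF inv]
  from rotation_permutation[OF c] obtain \<pi> where \<pi>: "\<pi> permutes {1..n} - Z" "\<And>i. A' i = A (\<pi> i)"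
    "\<And>i. i \<notin> {1..n} - Z \<Longrightarrow> A' i = A i" "\<And>i. val v i (A i) \<le> val v i (A' i)" by metis
  then have p: "\<pi> permutes {1..n}" by (meson Diff_subset permutes_subset)
  have in_n: "\<pi> i \<in> {1..n}" if "i \<in> {1..n}" for i using permutes_in_image[OF p] that by blast
  show ?thesis
    unfolding state_inv_def
  proof (intro conjI ballI)
    show "Z \<subseteq> {1..n}" "U \<subseteq> {1..m}" using I(1,2) by auto
    show "disjoint_family_on A' {1..n}"
      using I(3) in_n permutes_inj[OF p] unfolding disjoint_family_on_def \<pi>(2) by (metis injD)
    have "(\<Union>i\<in>{1..n}. A' i) = (\<Union>i\<in>\<pi> ` {1..n}. A i)" by (simp add: \<pi>(2) image_image)
    then show "(\<Union>i\<in>{1..n}. A' i) = {1..m} - U" unfolding permutes_image[OF p] using I(4) by simp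
    show "A' j = {}" if "j \<in> Z" for j using that I(5) \<pi>(3) by simp
    show "bundle_inv U (A' j)" if "j \<in> {1..n}" for j using I(8) in_n that by (simp add: \<pi>(2))
    show "\<gamma> / \<eta> * v j h \<le> val v j (A' j)" if "j \<in> {1..n} - Z" "h \<in> U" for j h
      using I(7)[OF that] \<pi>(4)[of j] by linarith
    show "approx_efx (\<gamma> / \<eta>) n m v A'"
      unfolding approx_efx_def
    proof (intro ballI)
      fix i j h assume "i \<in> {1..n}" "j \<in> {1..n}" "h \<in> A' j \<inter> pos_goods m v i"
      then have "\<gamma> / \<eta> * val v i (A' j - {h}) \<le> val v i (A i)"
        using I(6) in_n unfolding approx_efx_def \<pi>(2) by blast
      then show "\<gamma> / \<eta> * val v i (A' j - {h}) \<le> val v i (A' i)" using \<pi>(4)[of i] by linarith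
    qed
  qed
qed

lemma config_inv_step: "labase_step n m v c c' \<Longrightarrow> config_inv c \<Longrightarrow> config_inv c'"
  by (induction rule: labase_step.induct) (auto intro: inv_if_case inv_assign inv_rotate)

lemma config_inv_steps: "(labase_step n m v)\<^sup>*\<^sup>* (labase_init n m) c \<Longrightarrow> config_inv c"
  by (induction rule: rtranclp_induct) (auto simp: labase_init_def inv_init simp del: One_nat_def intro: config_inv_step)

lemma output_correct:
  assumes "labase_output n m v A"
  shows "allocation n m A" "approx_efx (2 * \<gamma> / (sqrt (5 + 4 * \<gamma>) - 1)) n m v A"
proof -
  obtain Z where "state_inv A {} Z"
    using assms config_inv_steps unfolding labase_output_def by fastforce
  note I = state_invD[OF this]
  show "allocation n m A" using I(3,4) by (simp add: allocation_def)
  show "approx_efx (2 * \<gamma> / (sqrt (5 + 4 * \<gamma>) - 1)) n m v A" using I(6) by (simp add: eta_def mult.commute)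
qed

subsection \<open>Termination and progress\<close>

text \<open>In \<open>Resolve\<close> the selected good already counts as spent although it is still
  in \<open>U\<close>. Its weight \<open>n * n + 2\<close> exceeds 1 plus the number of envy edges,
  so both entering and leaving \<open>Resolve\<close> decrease the measure.\<close>

fun config_measure :: "config \<Rightarrow> nat" where
  "config_measure (Loop A U Z) = (n * n + 2) * card U"
| "config_measure (Resolve A U Z g) =
     (n * n + 2) * (card U - 1) + 1 + card (envy_graph v ({1..n} - Z) A)"

lemma config_measure_step:
  assumes "labase_step n m v c c'" "config_inv c"
  shows "config_measure c' < config_measure c"
  using assms
proof (induction rule: labase_step.induct)
  case (if_case U g i Z f A)
  have "finite U" using if_case state_invD(2)[of A U Z] by (auto intro: finite_subset)
  moreover have "f \<in> U" using if_case by (auto simp: is_arg_max_def near_top_def)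
  ultimately show ?case using card_Diff1_less[of U f] by (simp only: config_measure.simps mult_less_mono2)
next
  case (else_case U g Z A)
  have "finite U" using else_case state_invD(2)[of A U Z] by (auto intro: finite_subset)
  moreover have "g \<in> U" using else_case by (auto simp: is_arg_max_def)
  ultimately have "0 < card U" by (auto simp: card_gt_0_iff)
  then obtain k where "card U = Suc k" by (cases "card U") auto
  then show ?case using card_envy_graph_le[of "{1..n} - Z" n v A] by simp
next
  case (rotate Z A c A' U g)
  then show ?case using rotation_decreases_envy[of "{1..n} - Z" v A c A'] by simp
next
  case (assign Z A s U g)
  then show ?case by (simp add: is_arg_max_def)
qed

lemma steps_bound:
  assumes "(labase_step n m v ^^ k) (labase_init n m) c"
  shows "config_measure c + k \<le> (n * n + 2) * m \<and> config_inv c"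
  using assms
proof (induction k arbitrary: c)
  case 0
  then show ?case by (auto simp: labase_init_def inv_init simp del: One_nat_def)
next
  case (Suc k)
  then obtain d where "(labase_step n m v ^^ k) (labase_init n m) d" "labase_step n m v d c" by auto
  with Suc.IH[of d] config_measure_step[of d c] config_inv_step[of d c] show ?case by auto
qed

section \<open>The choices required by the algorithm exist\<close>

lemma ex_arg_max:
  assumes "finite U" "U \<noteq> {}" shows "\<exists>g. is_arg_max (f :: nat \<Rightarrow> real) (\<lambda>h. h \<in> U) g"
proof -
  have "Max (f ` U) \<in> f ` U" using assms by (intro Max_in) auto
  then obtain g where "g \<in> U" "f g = Max (f ` U)" by auto
  then show ?thesis using assms by (intro exI[of _ g]) (auto simp: is_arg_max_def not_less)
qed

lemma near_top_arg_max:
  assumes "U \<subseteq> {1..m}" "is_arg_max bv (\<lambda>h. h \<in> U) g"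
  shows "h \<in> near_top n m v U \<longleftrightarrow> h \<in> U \<and> \<eta> * bv g \<le> bv h" "g \<in> near_top n m v U"
proof -
  have fin: "finite U" using assms(1) by (rule finite_subset) simp
  show *: "h \<in> near_top n m v U \<longleftrightarrow> h \<in> U \<and> \<eta> * bv g \<le> bv h" for h
    by (simp add: near_top_def Max_arg_max[OF fin assms(2)])
  have g: "g \<in> U" using assms(2) by (simp add: is_arg_max_def)
  then have "0 < bv g" using assms(1) base_value_pos by blast
  then have "\<eta> * bv g \<le> 1 * bv g" using eta_le_1 by (intro mult_right_mono) auto
  then show "g \<in> near_top n m v U" using g by (simp add: *)
qed

text \<open>Some agent values \<open>g\<close> positively and therefore lies outside
  \<open>Z\<close>, so the acyclic graph has a vertex.\<close>

lemma ex_source: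
  assumes "state_inv A U Z" "g \<in> U" "\<forall>i\<in>Z. v i g = 0" "acyclic (envy_graph v ({1..n} - Z) A)"
  obtains s where "source ({1..n} - Z) (envy_graph v ({1..n} - Z) A) s"
proof -
  have "g \<in> {1..m}" using assms state_invD(2) by blast
  then obtain i where "i \<in> {1..n}" "v i g > 0" using ex_pos by blast
  then have "i \<in> {1..n} - Z" using assms(3) by auto
  then have "{1..n} - Z \<noteq> {}" by blast
  moreover have "finite (envy_graph v ({1..n} - Z) A)" by (intro finite_envy_graph) simp
  ultimately show ?thesis using acyclic_source[OF assms(4)] that by metis
qed

lemma progress:
  assumes "config_inv c"
  shows "(\<exists>c'. labase_step n m v c c') \<or> (\<exists>A Z. c = Loop A {} Z)"
proof (cases c)
  case (Loop A U Z)
  then have inv: "state_inv A U Z" using assms by simp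
  note I = state_invD[OF inv]
  have fin: "finite U" using I(2) by (rule finite_subset) simp
  show ?thesis
  proof (cases "U = {}")
    case False
    then obtain g where g: "is_arg_max bv (\<lambda>h. h \<in> U) g" using ex_arg_max[OF fin] by blast
    then have gm: "g \<in> {1..m}" using I(2) by (auto simp: is_arg_max_def)
    show ?thesis
    proof (cases "\<exists>i\<in>Z. v i g > 0")
      case True
      then obtain i where i: "i \<in> Z" "v i g > 0" by blast
      have "finite (near_top n m v U)" using fin by (simp add: near_top_def)
      then obtain f where f: "is_arg_max (v i) (\<lambda>h. h \<in> near_top n m v U) f"
        using near_top_arg_max(2)[OF I(2) g] ex_arg_max by blast
      show ?thesis unfolding Loop using if_case[OF g i f] by blast
    next
      case False
      have "v i g = 0" if "i \<in> Z" for i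
      proof -
        have "0 \<le> v i g" "\<not> v i g > 0" using that False v_nonneg gm I(1) by blast+
        then show ?thesis by simp
      qed
      then have "\<forall>i\<in>Z. v i g = 0" by blast
      then show ?thesis unfolding Loop using else_case[OF g] by blast
    qed
  qed (use Loop in simp)
next
  case (Resolve A U Z g)
  then have inv: "state_inv A U Z" and g: "g \<in> U" "\<forall>i\<in>Z. v i g = 0"
    using assms by (auto simp: is_arg_max_def)
  show ?thesis
  proof (cases "acyclic (envy_graph v ({1..n} - Z) A)")
    case True
    then obtain s where "source ({1..n} - Z) (envy_graph v ({1..n} - Z) A) s"
      using ex_source[OF inv g] by blast
    then show ?thesis unfolding Resolve using assign[OF True] by blast
  next
    case False
    then obtain c where c: "simple_cycle (envy_graph v ({1..n} - Z) A) c"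
      using not_acyclic_simple_cycle[OF finite_envy_graph] by (metis finite_Diff finite_atLeastAtMost)
    moreover from c have "distinct c" by (simp add: simple_cycle_def)
    then obtain A' where "rotate_bundles c A A'" using ex_rotate_bundles[of c A] by blast
    ultimately show ?thesis unfolding Resolve using rotate by blast
  qed
qed

end

section \<open>Reasoning about programs\<close>

text \<open>An upper bound for the running time when every loop makes at most \<open>N\<close> iterations,
  as a polynomial in \<open>N\<close>.\<close>

primrec cost :: "com \<Rightarrow> nat poly" where
  "cost SKIP = 1"
| "cost (NAssign x a b e) = 1"
| "cost (RAssign x a b e) = 1"
| "cost (Seq c d) = cost c + cost d"
| "cost (Cond b c d) = cost c + cost d + 1"
| "cost (While b c) = [:0, 1:] * (cost c + 1) + 1"

primrec nat_arrays :: "com \<Rightarrow> nat set" where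
  "nat_arrays SKIP = {}"
| "nat_arrays (NAssign x a b e) = {x}"
| "nat_arrays (RAssign x a b e) = {}"
| "nat_arrays (Seq c d) = nat_arrays c \<union> nat_arrays d"
| "nat_arrays (Cond b c d) = nat_arrays c \<union> nat_arrays d"
| "nat_arrays (While b c) = nat_arrays c"

primrec real_arrays :: "com \<Rightarrow> nat set" where
  "real_arrays SKIP = {}"
| "real_arrays (NAssign x a b e) = {}"
| "real_arrays (RAssign x a b e) = {x}"
| "real_arrays (Seq c d) = real_arrays c \<union> real_arrays d"
| "real_arrays (Cond b c d) = real_arrays c \<union> real_arrays d"
| "real_arrays (While b c) = real_arrays c"

text \<open>Changes are tracked by whole arrays rather than by entries, so that a frame can be read
  off the program text.\<close>

definition same :: "nat set \<Rightarrow> nat set \<Rightarrow> mem \<Rightarrow> mem \<Rightarrow> bool" where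
  "same X Y s s' \<longleftrightarrow> (\<forall>x a b. x \<notin> X \<longrightarrow> nats s' (x, a, b) = nats s (x, a, b)) \<and>
     (\<forall>y a b. y \<notin> Y \<longrightarrow> reals s' (y, a, b) = reals s (y, a, b))"

lemma same_nats: "same X Y s s' \<Longrightarrow> x \<notin> X \<Longrightarrow> nats s' (x, a, b) = nats s (x, a, b)"
  and same_reals: "same X Y s s' \<Longrightarrow> y \<notin> Y \<Longrightarrow> reals s' (y, a, b) = reals s (y, a, b)"
  by (auto simp: same_def)

lemma same_trans: "same X Y s s' \<Longrightarrow> same X Y s' s'' \<Longrightarrow> same X Y s s''"
  by (simp add: same_def)

lemma same_mono: "same X Y s s' \<Longrightarrow> X \<subseteq> X' \<Longrightarrow> Y \<subseteq> Y' \<Longrightarrow> same X' Y' s s'"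
  unfolding same_def by blast

lemma exec_same: "exec c s t s' \<Longrightarrow> same (nat_arrays c) (real_arrays c) s s'"
  by (induction rule: exec.induct) (auto simp: same_def)

text \<open>A total-correctness triple whose time bound depends on the text and \<open>N\<close>
  only; a proof has to control iteration counts, never times.\<close>

definition run :: "nat \<Rightarrow> com \<Rightarrow> mem \<Rightarrow> (mem \<Rightarrow> bool) \<Rightarrow> bool" where
  "run N c s Q \<longleftrightarrow> (\<exists>t s'. exec c s t s' \<and> t \<le> poly (cost c) N \<and> Q s')"

text \<open>Supplies the unchanged arrays at the point of use, so that specifications of programs
  state effects only.\<close>

lemma run_frame:
  assumes "run N c s P" "\<And>s'. same (nat_arrays c) (real_arrays c) s s' \<Longrightarrow> P s' \<Longrightarrow> Q s'"
  shows "run N c s Q"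
  using assms exec_same unfolding run_def by meson

lemma run_Skip: "Q s \<Longrightarrow> run N SKIP s Q"
  unfolding run_def using exec.Skip by fastforce

lemma run_NAssign:
  "Q (s\<lparr>nats := (nats s)((x, nval a s, nval b s) := nval e s)\<rparr>) \<Longrightarrow> run N (NAssign x a b e) s Q"
  unfolding run_def using exec.NAssign by fastforce

lemma run_RAssign:
  "Q (s\<lparr>reals := (reals s)((x, nval a s, nval b s) := rval e s)\<rparr>) \<Longrightarrow> run N (RAssign x a b e) s Q"
  unfolding run_def using exec.RAssign by fastforce

lemma run_Seq:
  assumes "run N c s (\<lambda>s'. run N d s' Q)" shows "run N (Seq c d) s Q"
proof -
  from assms obtain t s' u s'' where "exec c s t s'" "t \<le> poly (cost c) N"
    "exec d s' u s''" "u \<le> poly (cost d) N" "Q s''" unfolding run_def by blast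
  then show ?thesis unfolding run_def
    by (intro exI[of _ "t + u"] exI[of _ s'']) (auto intro: exec.Seq)
qed

lemma run_Cond:
  assumes "bval b s \<Longrightarrow> run N c s Q" "\<not> bval b s \<Longrightarrow> run N d s Q" shows "run N (Cond b c d) s Q"
proof (cases "bval b s")
  case True
  then obtain t s' where "exec c s t s'" "t \<le> poly (cost c) N" "Q s'" using assms unfolding run_def by blast
  then show ?thesis unfolding run_def using True
    by (intro exI[of _ "t + 1"] exI[of _ s']) (auto intro: exec.CondTrue simp del: One_nat_def)
next
  case False
  then obtain t s' where "exec d s t s'" "t \<le> poly (cost d) N" "Q s'" using assms unfolding run_def by blast
  then show ?thesis unfolding run_def using False
    by (intro exI[of _ "t + 1"] exI[of _ s']) (auto intro: exec.CondFalse simp del: One_nat_def)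
qed

text \<open>The measure bounds the number of remaining iterations, so it has to be compared with
  \<open>N\<close> only at the start.\<close>

lemma run_While:
  fixes \<mu> :: "mem \<Rightarrow> nat"
  assumes I: "I s" and \<mu>: "\<mu> s \<le> N"
    and step: "\<And>s'. I s' \<Longrightarrow> bval b s' \<Longrightarrow> run N c s' (\<lambda>s''. I s'' \<and> \<mu> s'' < \<mu> s')"
    and post: "\<And>s'. I s' \<Longrightarrow> \<not> bval b s' \<Longrightarrow> Q s'"
  shows "run N (While b c) s Q"
proof -
  let ?C = "poly (cost c) N"
  have "\<exists>t s'. exec (While b c) s t s' \<and> t \<le> k * (?C + 1) + 1 \<and> Q s'" if "I s" "\<mu> s \<le> k" for k s
    using that
  proof (induction k arbitrary: s)
    case 0
    \<comment> \<open>At measure 0 a true guard would produce a smaller measure.\<close>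
    then have "\<not> bval b s" using step[of s] by (auto simp: run_def)
    then show ?case using post 0 by (intro exI[of _ 1] exI[of _ s]) (auto intro: exec.WhileFalse simp del: One_nat_def)
  next
    case (Suc k)
    show ?case
    proof (cases "bval b s")
      case True
      from step[OF Suc.prems(1) True] obtain t s' where 1: "exec c s t s'" "t \<le> ?C" "I s'" "\<mu> s' < \<mu> s"
        unfolding run_def by blast
      with Suc.IH[of s'] Suc.prems obtain u s'' where
        2: "exec (While b c) s' u s''" "u \<le> k * (?C + 1) + 1" "Q s''" by auto
      have "exec (While b c) s (t + u + 1) s''" using True 1 2 by (intro exec.WhileTrue)
      moreover have "t + u + 1 \<le> Suc k * (?C + 1) + 1" using 1(2) 2(2) by simp
      ultimately show ?thesis using 2 by blast
    next
      case False
      then show ?thesis using post Suc.prems by (intro exI[of _ 1] exI[of _ s]) (auto intro: exec.WhileFalse simp del: One_nat_def)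
    qed
  qed
  from this[OF I \<mu>] show ?thesis unfolding run_def by simp
qed

section \<open>Counted loops and searches\<close>

abbreviation V :: "nat \<Rightarrow> nexp" where "V x \<equiv> NVar x (NConst 0) (NConst 0)"
abbreviation arr :: "nat \<Rightarrow> nexp \<Rightarrow> nexp" where "arr x a \<equiv> NVar x a (NConst 0)"
abbreviation set_nat :: "nat \<Rightarrow> nexp \<Rightarrow> com" where "set_nat x e \<equiv> NAssign x (NConst 0) (NConst 0) e"
abbreviation set_real :: "nat \<Rightarrow> rexp \<Rightarrow> com" where "set_real x e \<equiv> RAssign x (NConst 0) (NConst 0) e"

definition For :: "nat \<Rightarrow> nat \<Rightarrow> com \<Rightarrow> com" where
  "For x y c = Seq (set_nat x (NConst 1))
     (While (BNot (NLess (V y) (V x))) (Seq c (set_nat x (NAdd (V x) (NConst 1)))))"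

lemma arrays_For [simp]: "nat_arrays (For x y c) = insert x (nat_arrays c)" "real_arrays (For x y c) = real_arrays c"
  by (auto simp: For_def)

text \<open>The index of the invariant is the number of finished passes, so during a pass the
  counter is one larger. Stability under changes of the counter cell carries the invariant across
  the increment. In the uses below, cases 5 to 8 are the start, this stability, one pass and the
  exit.\<close>

lemma run_For:
  assumes x: "x \<notin> nat_arrays c" "y \<notin> nat_arrays c" "x \<noteq> y" and N: "nats s (y, 0, 0) \<le> N"
    and I0: "I 0 s"
    and stable: "\<And>k s' j. I k s' \<Longrightarrow> I k (s'\<lparr>nats := (nats s')((x, 0, 0) := j)\<rparr>)"
    and step: "\<And>k s'. k < nats s (y, 0, 0) \<Longrightarrow> I k s' \<Longrightarrow> nats s' (x, 0, 0) = Suc k \<Longrightarrow>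
      same (insert x (nat_arrays c)) (real_arrays c) s s' \<Longrightarrow> run N c s' (I (Suc k))"
    and post: "\<And>s'. I (nats s (y, 0, 0)) s' \<Longrightarrow> same (insert x (nat_arrays c)) (real_arrays c) s s' \<Longrightarrow> Q s'"
  shows "run N (For x y c) s Q"
proof -
  let ?B = "nats s (y, 0, 0)" and ?same = "same (insert x (nat_arrays c)) (real_arrays c) s"
  let ?s = "s\<lparr>nats := (nats s)((x, 0, 0) := 1)\<rparr>"
  let ?inc = "set_nat x (NAdd (V x) (NConst 1))"
  define J where "J s' \<longleftrightarrow> (\<exists>k \<le> ?B. nats s' (x, 0, 0) = Suc k \<and> I k s') \<and> ?same s'" for s'
  have "run N (While (BNot (NLess (V y) (V x))) (Seq c ?inc)) ?s Q"
  proof (rule run_While[where I = J and \<mu> = "\<lambda>s'. Suc ?B - nats s' (x, 0, 0)"])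
    show "J ?s" using stable[OF I0] by (auto simp: J_def same_def)
    show "Suc ?B - nats ?s (x, 0, 0) \<le> N" using N by simp
  next
    fix s' assume J: "J s'" and b: "bval (BNot (NLess (V y) (V x))) s'"
    then obtain k where k: "nats s' (x, 0, 0) = Suc k" "I k s'" "?same s'" by (auto simp: J_def)
    have kB: "k < ?B" using b k x same_nats[OF k(3), of y 0 0] by simp
    have "run N c s' (I (Suc k))" using step kB k by blast
    then show "run N (Seq c ?inc) s' (\<lambda>s''. J s'' \<and> Suc ?B - nats s'' (x, 0, 0) < Suc ?B - nats s' (x, 0, 0))"
    proof (rule run_Seq[OF run_frame])
      fix s'' assume s'': "same (nat_arrays c) (real_arrays c) s' s''" "I (Suc k) s''"
      have "nats s'' (x, 0, 0) = Suc k" using same_nats[OF s''(1)] x k by simp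
      moreover have "?same s''"
        using same_trans[OF k(3) same_mono[OF s''(1)]] by blast
      ultimately show "run N ?inc s'' (\<lambda>s''. J s'' \<and> Suc ?B - nats s'' (x, 0, 0) < Suc ?B - nats s' (x, 0, 0))"
        using kB k stable[OF s''(2)] by (intro run_NAssign) (auto simp: J_def same_def)
    qed
  next
    fix s' assume J: "J s'" and b: "\<not> bval (BNot (NLess (V y) (V x))) s'"
    then obtain k where k: "k \<le> ?B" "nats s' (x, 0, 0) = Suc k" "I k s'" "?same s'" by (auto simp: J_def)
    moreover have "k = ?B" using b k x same_nats[OF k(4), of y 0 0] by simp
    ultimately show "Q s'" using post by blast
  qed
  then show ?thesis unfolding For_def by (intro run_Seq run_NAssign) simp
qed

text \<open>Agents and goods are numbered from 1, which leaves 0 free to signal failure.\<close>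

definition Find :: "nat \<Rightarrow> nat \<Rightarrow> nat \<Rightarrow> bexp \<Rightarrow> com" where
  "Find z x y b = Seq (set_nat z (NConst 0)) (For x y (Cond b (set_nat z (V x)) SKIP))"

lemma arrays_Find [simp]: "nat_arrays (Find z x y b) = {x, z}" "real_arrays (Find z x y b) = {}"
  by (auto simp: Find_def)

lemma run_Find:
  assumes x: "x \<noteq> y" "z \<noteq> y" "x \<noteq> z" and N: "nats s (y, 0, 0) \<le> N"
    and b: "\<And>s' j. same {x, z} {} s s' \<Longrightarrow> nats s' (x, 0, 0) = j \<Longrightarrow> j \<in> {1..nats s (y, 0, 0)} \<Longrightarrow>
      bval b s' \<longleftrightarrow> P j"
    and post: "\<And>s' r. same {x, z} {} s s' \<Longrightarrow> nats s' (z, 0, 0) = r \<Longrightarrow>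
      r = 0 \<and> (\<forall>j\<in>{1..nats s (y, 0, 0)}. \<not> P j) \<or> r \<in> {1..nats s (y, 0, 0)} \<and> P r \<Longrightarrow> Q s'"
  shows "run N (Find z x y b) s Q"
  unfolding Find_def
proof (intro run_Seq run_NAssign)
  let ?s = "s\<lparr>nats := (nats s)((z, nval (NConst 0) s, nval (NConst 0) s) := nval (NConst 0) s)\<rparr>"
  let ?B = "nats s (y, 0, 0)"
  have B: "nats ?s (y, 0, 0) = ?B" using x by simp
  have tr: "same {x, z} {} s s'" if "same (insert x {z}) {} ?s s'" for s'
    using that by (auto simp: same_def)
  show "run N (For x y (Cond b (set_nat z (V x)) SKIP)) ?s Q"
  proof (rule run_For[where I = "\<lambda>k s'. nats s' (z, 0, 0) = 0 \<and> (\<forall>j\<in>{1..k}. \<not> P j) \<or>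
      nats s' (z, 0, 0) \<in> {1..k} \<and> P (nats s' (z, 0, 0))"], goal_cases)
    case (7 k s')
    have s: "same {x, z} {} s s'" using 7(4) by (intro tr) simp
    have "bval b s' \<longleftrightarrow> P (Suc k)" using b[OF s 7(3)] 7(1) B by simp
    then show ?case using 7(2,3) x
      by (intro run_Cond run_NAssign run_Skip) (auto simp: atLeastAtMostSuc_conv)
  next
    case (8 s')
    have "same {x, z} {} s s'" using 8(2) by (intro tr) simp
    then show ?case using 8(1) post B by metis
  qed (use x N in auto)
qed

text \<open>While nothing has been found, \<open>z\<close> is 0 and the comparison reads the default
  entry at index 0. It must not exceed any candidate, hence the premise on \<open>F 0\<close> in
  \<open>run_Best\<close>; ties are accepted so that the first candidate always wins.\<close>

definition Best :: "nat \<Rightarrow> nat \<Rightarrow> nat \<Rightarrow> bexp \<Rightarrow> (nat \<Rightarrow> rexp) \<Rightarrow> com" where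
  "Best z x y b e = Seq (set_nat z (NConst 0))
     (For x y (Cond (BAnd b (BNot (RLess (e x) (e z)))) (set_nat z (V x)) SKIP))"

lemma arrays_Best [simp]: "nat_arrays (Best z x y b e) = {x, z}" "real_arrays (Best z x y b e) = {}"
  by (auto simp: Best_def)

lemma run_Best:
  assumes x: "x \<noteq> y" "z \<noteq> y" "x \<noteq> z" and N: "nats s (y, 0, 0) \<le> N"
    and F: "\<And>j. j \<in> {1..nats s (y, 0, 0)} \<Longrightarrow> F 0 \<le> F j"
    and b: "\<And>s' j. same {x, z} {} s s' \<Longrightarrow> nats s' (x, 0, 0) = j \<Longrightarrow> j \<in> {1..nats s (y, 0, 0)} \<Longrightarrow>
      bval b s' \<longleftrightarrow> P j"
    and e: "\<And>s' w. same {x, z} {} s s' \<Longrightarrow> w \<in> {x, z} \<Longrightarrow> nats s' (w, 0, 0) \<in> {0..nats s (y, 0, 0)} \<Longrightarrow>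
      rval (e w) s' = F (nats s' (w, 0, 0))"
    and post: "\<And>s' r. same {x, z} {} s s' \<Longrightarrow> nats s' (z, 0, 0) = r \<Longrightarrow>
      r = 0 \<and> (\<forall>j\<in>{1..nats s (y, 0, 0)}. \<not> P j) \<or>
      r \<in> {1..nats s (y, 0, 0)} \<and> P r \<and> (\<forall>j\<in>{1..nats s (y, 0, 0)}. P j \<longrightarrow> F j \<le> F r) \<Longrightarrow> Q s'"
  shows "run N (Best z x y b e) s Q"
  unfolding Best_def
proof (intro run_Seq run_NAssign)
  let ?s = "s\<lparr>nats := (nats s)((z, nval (NConst 0) s, nval (NConst 0) s) := nval (NConst 0) s)\<rparr>"
  let ?B = "nats s (y, 0, 0)"
  have B: "nats ?s (y, 0, 0) = ?B" using x by simp
  have tr: "same {x, z} {} s s'" if "same (insert x {z}) {} ?s s'" for s'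
    using that by (auto simp: same_def)
  let ?I = "\<lambda>k s'. nats s' (z, 0, 0) = 0 \<and> (\<forall>j\<in>{1..k}. \<not> P j) \<or>
      nats s' (z, 0, 0) \<in> {1..k} \<and> P (nats s' (z, 0, 0)) \<and> (\<forall>j\<in>{1..k}. P j \<longrightarrow> F j \<le> F (nats s' (z, 0, 0)))"
  show "run N (For x y (Cond (BAnd b (BNot (RLess (e x) (e z)))) (set_nat z (V x)) SKIP)) ?s Q"
  proof (rule run_For[where I = ?I], goal_cases)
    case (7 k s')
    have s: "same {x, z} {} s s'" using 7(4) by (intro tr) simp
    have kB: "k < ?B" using 7(1) B by simp
    have z: "nats s' (z, 0, 0) \<le> k" using 7(2) by auto
    have "bval b s' \<longleftrightarrow> P (Suc k)" using b[OF s 7(3)] kB by simp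
    moreover have "rval (e x) s' = F (Suc k)" using e[OF s, of x] kB 7(3) by simp
    moreover have "rval (e z) s' = F (nats s' (z, 0, 0))" using e[OF s, of z] kB z by simp
    moreover have "F 0 \<le> F (Suc k)" using F kB by simp
    ultimately show ?case using 7(2,3) x
      by (intro run_Cond run_NAssign run_Skip) (auto simp: atLeastAtMostSuc_conv intro: order_trans)
  next
    case (8 s')
    have "same {x, z} {} s s'" using 8(2) by (intro tr) simp
    then show ?case using 8(1) post[OF _ refl] B by simp
  qed (use x N in auto)
qed

section \<open>A program for the algorithm\<close>

text \<open>Natural arrays: 2 owners (0 if unassigned), 3 agents with a nonempty bundle, 4 agents not yet deleted in
  the search for a cycle, 5 predecessors, 6 new owners in a rotation, 7 the selected good, 8 the agent and
  9 the good of the if-case, 13 a source, 14 and 16 results of searches, 15 the loop flag, 10, 11, 12, 17 loop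
  counters. Real arrays: 1 squared base values, 2 \<open>\<gamma>\<close>, 3 values of bundles, 4 and 5 extreme values of a good.\<close>

abbreviation RS :: "nat \<Rightarrow> rexp" where "RS x \<equiv> RVar x (NConst 0) (NConst 0)"

definition max_prog :: com where
  "max_prog = Seq (set_real 4 (RConst 0))
     (For 11 0 (Cond (RLess (RS 4) (RVar 0 (V 11) (V 10))) (set_real 4 (RVar 0 (V 11) (V 10))) SKIP))"

text \<open>The running minimum starts at the maximum, which is itself a positive value of the good,
  in place of infinity.\<close>

definition min_prog :: com where
  "min_prog = Seq (set_real 5 (RS 4))
     (For 11 0 (Cond (BAnd (RLess (RConst 0) (RVar 0 (V 11) (V 10))) (RLess (RVar 0 (V 11) (V 10)) (RS 5)))
       (set_real 5 (RVar 0 (V 11) (V 10))) SKIP))"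

definition base_prog :: com where
  "base_prog = Seq (set_real 2 (RConst 1))
     (For 10 1 (Seq max_prog (Seq min_prog (Seq (RAssign 1 (V 10) (NConst 0) (RMul (RS 5) (RS 4)))
       (Cond (RLess (RDiv (RS 5) (RS 4)) (RS 2)) (set_real 2 (RDiv (RS 5) (RS 4))) SKIP)))))"

text \<open>One pass over the goods fills a whole row: each good is added to the column of its
  owner. Unassigned goods end up in column 0, which is outside \<open>values_ok\<close>.\<close>

definition value_prog :: com where
  "value_prog = For 10 0 (Seq (For 11 0 (RAssign 3 (V 10) (V 11) (RConst 0)))
     (For 11 1 (RAssign 3 (V 10) (arr 2 (V 11))
       (RAdd (RVar 3 (V 10) (arr 2 (V 11))) (RVar 0 (V 10) (V 11))))))"

text \<open>One sweep serves both purposes: an agent envied by some active agent gets that one as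
  predecessor, an agent without such is recorded in 13. Array 3 as parameter gives the source for an
  assignment, array 4 a step of the cycle search.\<close>

definition source_prog :: "nat \<Rightarrow> com" where
  "source_prog a = Seq (set_nat 13 (NConst 0))
     (For 10 0 (Cond (NLess (NConst 0) (arr a (V 10)))
       (Seq (Find 14 11 0 (BAnd (NLess (NConst 0) (arr a (V 11)))
              (RLess (RVar 3 (V 11) (V 11)) (RVar 3 (V 11) (V 10)))))
         (Seq (NAssign 5 (V 10) (NConst 0) (V 14))
           (Cond (NLess (NConst 0) (V 14)) SKIP (set_nat 13 (V 10)))))
       SKIP))"

text \<open>At most \<open>n\<close> deletions are possible, so \<open>n\<close> sweeps suffice. A
  sweep without a source leaves 0 in 13, and the deletion then hits entry 0, which is no
  agent.\<close>

definition core_prog :: com where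
  "core_prog = Seq (For 10 0 (NAssign 4 (V 10) (NConst 0) (arr 3 (V 10))))
     (For 12 0 (Seq (source_prog 4) (NAssign 4 (V 13) (NConst 0) (NConst 0))))"

lemma arrays_progs [simp]:
  "nat_arrays max_prog = {11}" "real_arrays max_prog = {4}"
  "nat_arrays min_prog = {11}" "real_arrays min_prog = {5}"
  "nat_arrays base_prog = {10, 11}" "real_arrays base_prog = {1, 2, 4, 5}"
  "nat_arrays value_prog = {10, 11}" "real_arrays value_prog = {3}"
  "nat_arrays (source_prog a) = {5, 10, 11, 13, 14}" "real_arrays (source_prog a) = {}"
  "nat_arrays core_prog = {4, 5, 10, 11, 12, 13, 14}" "real_arrays core_prog = {}"
  by (auto simp: max_prog_def min_prog_def base_prog_def value_prog_def source_prog_def core_prog_def)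

text \<open>The bound \<open>n * n + 1\<close> is for resolving cycles: each round removes an envy
  edge, except the last one, which lowers the flag.\<close>

locale fd_program = fd_instance +
  fixes N :: nat
  assumes N: "n \<le> N" "m \<le> N" "n * n + 1 \<le> N"
begin

definition inp :: "mem \<Rightarrow> bool" where
  "inp s \<longleftrightarrow> nats s (0, 0, 0) = n \<and> nats s (1, 0, 0) = m \<and>
     (\<forall>i g. reals s (0, i, g) = (if i \<in> {1..n} \<and> g \<in> {1..m} then v i g else 0))"

lemma inpD:
  assumes "inp s"
  shows "nats s (0, 0, 0) = n" "nats s (1, 0, 0) = m"
    "i \<in> {1..n} \<Longrightarrow> g \<in> {1..m} \<Longrightarrow> reals s (0, i, g) = v i g"
  using assms by (auto simp: inp_def)

lemma inp_same: "same X Y s s' \<Longrightarrow> inp s \<Longrightarrow> 0 \<notin> X \<Longrightarrow> 1 \<notin> X \<Longrightarrow> 0 \<notin> Y \<Longrightarrow> inp s'"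
  by (simp add: inp_def same_nats same_reals)

subsection \<open>Base values\<close>

lemma run_max:
  assumes inp: "inp s" and h: "nats s (10, 0, 0) = h" "h \<in> {1..m}"
  shows "run N max_prog s (\<lambda>s'. reals s' (4, 0, 0) = max_value n v h)"
  unfolding max_prog_def
proof (intro run_Seq run_RAssign, rule run_For[where I = "\<lambda>k s'. (\<forall>i\<in>{1..k}. v i h \<le> reals s' (4, 0, 0)) \<and>
    (reals s' (4, 0, 0) = 0 \<or> reals s' (4, 0, 0) \<in> (\<lambda>i. v i h) ` {1..n})"], goal_cases)
  case (7 k s')
  then have "reals s' (0, Suc k, h) = v (Suc k) h" "nats s' (10, 0, 0) = h"
    using inp h inpD(1)[OF inp] by (auto simp: inp_def same_def)
  then show ?case using 7(1-3) inpD(1)[OF inp]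
    by (intro run_Cond run_RAssign run_Skip) (auto simp: atLeastAtMostSuc_conv)
next
  case (8 s')
  then have ge: "\<And>i. i \<in> {1..n} \<Longrightarrow> v i h \<le> reals s' (4, 0, 0)"
    and mem: "reals s' (4, 0, 0) = 0 \<or> reals s' (4, 0, 0) \<in> (\<lambda>i. v i h) ` {1..n}"
    using inpD(1)[OF inp] by auto
  \<comment> \<open>A positive value rules out that the register still holds its initial 0.\<close>
  obtain i where "i \<in> {1..n}" "0 < v i h" using ex_pos h by blast
  with ge[of i] mem have "reals s' (4, 0, 0) \<in> (\<lambda>i. v i h) ` {1..n}" by auto
  then show ?case unfolding max_value_def using ge by (intro Max_eqI[symmetric]) auto
qed (use inpD(1)[OF inp] N in auto)

lemma run_min:
  assumes inp: "inp s" and h: "nats s (10, 0, 0) = h" "h \<in> {1..m}"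
    and mx: "reals s (4, 0, 0) = max_value n v h"
  shows "run N min_prog s (\<lambda>s'. reals s' (5, 0, 0) = min_value h)"
  unfolding min_prog_def
proof (intro run_Seq run_RAssign, rule run_For[where I = "\<lambda>k s'. (\<forall>i\<in>{1..k}. 0 < v i h \<longrightarrow> reals s' (5, 0, 0) \<le> v i h) \<and>
    reals s' (5, 0, 0) \<in> (\<lambda>i. v i h) ` {i \<in> {1..n}. 0 < v i h}"], goal_cases)
  case 5
  have "max_value n v h \<in> (\<lambda>i. v i h) ` {1..n}"
    unfolding max_value_def using n_pos by (intro Max_in) auto
  then show ?case using max_value_pos[OF h(2)] mx by auto
next
  case (7 k s')
  then have "reals s' (0, Suc k, h) = v (Suc k) h" "nats s' (10, 0, 0) = h"
    using inp h inpD(1)[OF inp] by (auto simp: inp_def same_def)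
  then show ?case using 7(1-3) inpD(1)[OF inp]
    by (intro run_Cond run_RAssign run_Skip) (auto simp: atLeastAtMostSuc_conv)
next
  case (8 s')
  then show ?case unfolding min_value_def using inpD(1)[OF inp] by (intro Min_eqI[symmetric]) auto
qed (use inpD(1)[OF inp] N in auto)

text \<open>Entry 0 of array 1 is the default value read by \<open>Best\<close> before a top good
  has been found.\<close>

definition base_ok :: "mem \<Rightarrow> bool" where
  "base_ok s \<longleftrightarrow> (\<forall>h\<in>{1..m}. reals s (1, h, 0) = (bv h)\<^sup>2) \<and> reals s (1, 0, 0) = 0 \<and> reals s (2, 0, 0) = \<gamma>"

lemma run_base:
  assumes inp: "inp s" and zero: "reals s (1, 0, 0) = 0"
  shows "run N base_prog s base_ok"
proof -
  \<comment> \<open>The 1 is the initial value of the running minimum; it disappears at the end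
    because \<gamma> \<le> 1.\<close>
  define M where "M k = Min (insert 1 (good_range n v ` {1..k}))" for k
  have M_Suc: "M (Suc k) = min (good_range n v (Suc k)) (M k)" for k
  proof -
    have "insert 1 (good_range n v ` {1..Suc k}) = insert (good_range n v (Suc k)) (insert 1 (good_range n v ` {1..k}))"
      by (auto simp: atLeastAtMostSuc_conv)
    then show ?thesis by (simp add: M_def)
  qed
  have M_m: "M m = \<gamma>"
    using m_pos range_le_1 by (simp add: M_def range_param_def)
  show ?thesis
    unfolding base_prog_def
  proof (intro run_Seq run_RAssign, rule run_For[where I = "\<lambda>k s'. (\<forall>h\<in>{1..k}. reals s' (1, h, 0) = (bv h)\<^sup>2) \<and>
      reals s' (1, 0, 0) = 0 \<and> reals s' (2, 0, 0) = M k"], goal_cases)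
    case (7 k s1)
    then have h: "Suc k \<in> {1..m}" using inpD(2)[OF inp] by simp
    have in1: "inp s1" using inp 7(4) by (auto simp: inp_def same_def)
    show ?case
    proof (rule run_Seq[OF run_frame[OF run_max[OF in1 7(3) h]]])
      fix s2 assume s2: "same (nat_arrays max_prog) (real_arrays max_prog) s1 s2" "reals s2 (4, 0, 0) = max_value n v (Suc k)"
      have in2: "inp s2" "nats s2 (10, 0, 0) = Suc k" using inp_same[OF s2(1) in1] same_nats[OF s2(1)] 7(3) by auto
      show "run N (Seq min_prog (Seq (RAssign 1 (V 10) (NConst 0) (RMul (RS 5) (RS 4)))
         (Cond (RLess (RDiv (RS 5) (RS 4)) (RS 2)) (set_real 2 (RDiv (RS 5) (RS 4))) SKIP))) s2
         (\<lambda>s'. (\<forall>h\<in>{1..Suc k}. reals s' (1, h, 0) = (bv h)\<^sup>2) \<and>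
         reals s' (1, 0, 0) = 0 \<and> reals s' (2, 0, 0) = M (Suc k))"
      proof (rule run_Seq[OF run_frame[OF run_min[OF in2 h s2(2)]]])
        fix s3 assume s3: "same (nat_arrays min_prog) (real_arrays min_prog) s2 s3" "reals s3 (5, 0, 0) = min_value (Suc k)"
        have eq: "nats s3 (10, 0, 0) = Suc k" "reals s3 (4, 0, 0) = max_value n v (Suc k)"
          "\<And>a b. reals s3 (1, a, b) = reals s1 (1, a, b)" "reals s3 (2, 0, 0) = reals s1 (2, 0, 0)"
          using in2 s2 7(3) same_nats[OF s3(1)] same_reals[OF s3(1)] same_reals[OF s2(1)] by auto
        have b: "min_value (Suc k) * max_value n v (Suc k) = (bv (Suc k))\<^sup>2"
          using h max_value_pos[OF h] min_value_pos[OF h] by (simp add: base_value_eq)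
        show "run N (Seq (RAssign 1 (V 10) (NConst 0) (RMul (RS 5) (RS 4)))
         (Cond (RLess (RDiv (RS 5) (RS 4)) (RS 2)) (set_real 2 (RDiv (RS 5) (RS 4))) SKIP)) s3
         (\<lambda>s'. (\<forall>h\<in>{1..Suc k}. reals s' (1, h, 0) = (bv h)\<^sup>2) \<and>
         reals s' (1, 0, 0) = 0 \<and> reals s' (2, 0, 0) = M (Suc k))"
          using 7(2) eq s3(2) b good_range_eq[of "Suc k"] M_Suc[of k]
          by (intro run_Seq run_Cond run_RAssign run_Skip) (auto simp: atLeastAtMostSuc_conv min_def)
      qed
    qed
  next
    case (8 s')
    then show ?case using M_m inpD(2)[OF inp] by (simp add: base_ok_def)
  qed (use inpD(2)[OF inp] N zero in \<open>auto simp: M_def\<close>)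
qed

subsection \<open>The state represented in memory\<close>

text \<open>Owner 0 marks unassigned goods, while configurations give the non-agent 0 the empty set,
  as in \<open>labase_init\<close>; the case distinction makes the two agree as functions.\<close>

definition bundles :: "mem \<Rightarrow> nat \<Rightarrow> nat set" where
  "bundles s i = (if i = 0 then {} else output_bundles m s i)"

definition unassigned :: "mem \<Rightarrow> nat set" where
  "unassigned s = output_bundles m s 0"

definition active :: "nat \<Rightarrow> mem \<Rightarrow> nat set" where
  "active a s = {i \<in> {1..n}. 0 < nats s (a, i, 0)}"

definition empty_agents :: "mem \<Rightarrow> nat set" where
  "empty_agents s = {1..n} - active 3 s"

lemma state_same:
  assumes "same X Y s s'"
  shows "2 \<notin> X \<Longrightarrow> bundles s' = bundles s" "2 \<notin> X \<Longrightarrow> unassigned s' = unassigned s"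
    "a \<notin> X \<Longrightarrow> active a s' = active a s" "3 \<notin> X \<Longrightarrow> empty_agents s' = empty_agents s"
  using same_nats[OF assms]
  by (auto simp: bundles_def unassigned_def active_def empty_agents_def output_bundles_def fun_eq_iff)

definition values_ok :: "mem \<Rightarrow> bool" where
  "values_ok s \<longleftrightarrow> (\<forall>i\<in>{1..n}. \<forall>j\<in>{1..n}. reals s (3, i, j) = val v i (bundles s j))"

lemma values_same: "same X Y s s' \<Longrightarrow> 2 \<notin> X \<Longrightarrow> 3 \<notin> Y \<Longrightarrow> values_ok s \<Longrightarrow> values_ok s'"
  by (simp add: values_ok_def state_same same_reals)

lemma run_value_row:
  assumes inp: "inp s" and i: "nats s (10, 0, 0) = i" "i \<in> {1..n}"
  shows "run N (Seq (For 11 0 (RAssign 3 (V 10) (V 11) (RConst 0)))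
     (For 11 1 (RAssign 3 (V 10) (arr 2 (V 11))
       (RAdd (RVar 3 (V 10) (arr 2 (V 11))) (RVar 0 (V 10) (V 11)))))) s
     (\<lambda>s'. (\<forall>j\<in>{1..n}. reals s' (3, i, j) = val v i (bundles s j)) \<and>
       (\<forall>k j. k \<noteq> i \<longrightarrow> reals s' (3, k, j) = reals s (3, k, j)))"
proof (rule run_Seq, rule run_For[where I = "\<lambda>k s'. (\<forall>j\<in>{1..k}. reals s' (3, i, j) = 0) \<and>
    (\<forall>k j. k \<noteq> i \<longrightarrow> reals s' (3, k, j) = reals s (3, k, j))"], goal_cases)
  case (7 k s')
  then have "nats s' (10, 0, 0) = i" using i same_nats[OF 7(4), of 10] by simp
  then show ?case using 7(2,3) by (intro run_RAssign) (auto simp: atLeastAtMostSuc_conv)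
next
  case (8 s1)
  have in1: "inp s1" "nats s1 (10, 0, 0) = i" "\<And>g. nats s1 (2, g, 0) = nats s (2, g, 0)"
    using inp_same[OF 8(2) inp] same_nats[OF 8(2)] i by auto
  let ?I = "\<lambda>k s'. (\<forall>j\<in>{1..n}. reals s' (3, i, j) = val v i {g \<in> {1..k}. nats s (2, g, 0) = j}) \<and>
    (\<forall>k j. k \<noteq> i \<longrightarrow> reals s' (3, k, j) = reals s (3, k, j))"
  show ?case
  proof (rule run_For[where I = ?I], goal_cases)
    case (7 k s')
    have g: "Suc k \<in> {1..m}" using 7(1) inpD(2)[OF in1(1)] by simp
    have "inp s'" "nats s' (10, 0, 0) = i" "nats s' (2, Suc k, 0) = nats s (2, Suc k, 0)"
      using inp_same[OF 7(4) in1(1)] same_nats[OF 7(4)] in1 by auto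
    moreover from this have "reals s' (0, i, Suc k) = v i (Suc k)" using inpD(3) i g by blast
    moreover have "val v i {g \<in> {1..Suc k}. nats s (2, g, 0) = j} =
      (if nats s (2, Suc k, 0) = j then v i (Suc k) else 0) + val v i {g \<in> {1..k}. nats s (2, g, 0) = j}" for j
    proof (cases "nats s (2, Suc k, 0) = j")
      case True
      then have "{g \<in> {1..Suc k}. nats s (2, g, 0) = j} = insert (Suc k) {g \<in> {1..k}. nats s (2, g, 0) = j}"
        by (auto simp: atLeastAtMostSuc_conv)
      then show ?thesis using True by (simp add: val_def)
    next
      case False
      then have "{g \<in> {1..Suc k}. nats s (2, g, 0) = j} = {g \<in> {1..k}. nats s (2, g, 0) = j}"
        by (auto simp: le_Suc_eq)
      then show ?thesis using False by simp
    qed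
    ultimately show ?case using 7(2,3) by (intro run_RAssign) auto
  next
    case (8 s')
    then show ?case using inpD(2)[OF in1(1)] by (simp add: bundles_def output_bundles_def)
  next
    case 5
    then show ?case using 8(1) inpD(1)[OF inp] by (simp add: val_def)
  qed (use inpD(2)[OF in1(1)] N in auto)
qed (use inpD(1)[OF inp] N in auto)

lemma run_value:
  assumes inp: "inp s"
  shows "run N value_prog s values_ok"
  unfolding value_prog_def
proof (rule run_For[where I = "\<lambda>k s'. \<forall>i\<in>{1..k}. \<forall>j\<in>{1..n}. reals s' (3, i, j) = val v i (bundles s j)"], goal_cases)
  case (7 k s')
  have "inp s'" using inp_same[OF 7(4) inp] by simp
  moreover have "Suc k \<in> {1..n}" using 7(1) inpD(1)[OF inp] by simp
  moreover have "bundles s' = bundles s" using state_same(1)[OF 7(4)] by simp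
  ultimately show ?case using 7(2,3)
    by (intro run_frame[OF run_value_row[of s' "Suc k"]]) (auto simp: atLeastAtMostSuc_conv)
next
  case (8 s')
  moreover have "bundles s' = bundles s" using state_same(1)[OF 8(2)] by simp
  ultimately show ?case using inpD(1)[OF inp] by (simp add: values_ok_def)
qed (use inpD(1)[OF inp] N in auto)

subsection \<open>Sources and cycles of the envy graph\<close>

abbreviation envies :: "mem \<Rightarrow> nat \<Rightarrow> nat \<Rightarrow> bool" where
  "envies s i j \<equiv> reals s (3, i, i) < reals s (3, i, j)"

abbreviation pred_ok :: "nat set \<Rightarrow> mem \<Rightarrow> nat \<Rightarrow> bool" where
  "pred_ok R s j \<equiv> nats s (5, j, 0) \<in> R \<and> envies s (nats s (5, j, 0)) j"

lemma run_source:
  assumes inp: "inp s" and a: "a \<notin> {5, 10, 11, 13, 14}"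
  shows "run N (source_prog a) s (\<lambda>s'.
     nats s' (13, 0, 0) = 0 \<and> (\<forall>j\<in>active a s. pred_ok (active a s) s' j) \<or>
     nats s' (13, 0, 0) \<in> active a s \<and> (\<forall>i\<in>active a s. \<not> envies s i (nats s' (13, 0, 0))))"
  unfolding source_prog_def
proof (intro run_Seq run_NAssign, rule run_For[where I = "\<lambda>k s'.
    nats s' (13, 0, 0) = 0 \<and> (\<forall>j\<in>active a s \<inter> {1..k}. nats s' (5, j, 0) \<in> active a s \<and> envies s (nats s' (5, j, 0)) j) \<or>
    nats s' (13, 0, 0) \<in> active a s \<and> (\<forall>i\<in>active a s. \<not> envies s i (nats s' (13, 0, 0)))"], goal_cases)
  case (7 k s1)
  let ?R = "active a s"
  have j: "Suc k \<in> {1..n}" using 7(1) inpD(1)[OF inp] by simp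
  have s1: "inp s1" "\<And>j. nats s1 (a, j, 0) = nats s (a, j, 0)" "\<And>i j. reals s1 (3, i, j) = reals s (3, i, j)"
    using 7(4) inp a by (auto simp: inp_def same_def)
  have act: "i \<in> ?R \<longleftrightarrow> i \<in> {1..n} \<and> 0 < nats s (a, i, 0)" for i by (simp add: active_def)
  show ?case
  proof (rule run_Cond)
    assume "bval (NLess (NConst 0) (arr a (V 10))) s1"
    then have jR: "Suc k \<in> ?R" using 7(3) s1 j act by simp
    show "run N (Seq (Find 14 11 0 (BAnd (NLess (NConst 0) (arr a (V 11)))
              (RLess (RVar 3 (V 11) (V 11)) (RVar 3 (V 11) (V 10)))))
         (Seq (NAssign 5 (V 10) (NConst 0) (V 14))
           (Cond (NLess (NConst 0) (V 14)) SKIP (set_nat 13 (V 10))))) s1 (\<lambda>s'.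
      nats s' (13, 0, 0) = 0 \<and> (\<forall>j\<in>?R \<inter> {1..Suc k}. nats s' (5, j, 0) \<in> ?R \<and> envies s (nats s' (5, j, 0)) j) \<or>
      nats s' (13, 0, 0) \<in> ?R \<and> (\<forall>i\<in>?R. \<not> envies s i (nats s' (13, 0, 0))))"
    proof (rule run_Seq, rule run_Find[where P = "\<lambda>i. i \<in> ?R \<and> envies s i (Suc k)"], goal_cases)
      case (5 s' i)
      then show ?case using s1 7(3) a inpD(1)[OF s1(1)] same_nats[OF 5(1)] same_reals[OF 5(1)]
        by (auto simp: act)
    next
      case (6 s2 r)
      have "nats s2 (10, 0, 0) = Suc k" "\<And>j. nats s2 (5, j, 0) = nats s1 (5, j, 0)"
        "nats s2 (13, 0, 0) = nats s1 (13, 0, 0)"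
        using 7(3) same_nats[OF 6(1)] by auto
      moreover have "\<And>i. i \<in> ?R \<Longrightarrow> i \<in> {1..n}" "\<And>i. i \<in> ?R \<Longrightarrow> 0 < i" by (auto simp: act)
      ultimately show ?case using 6(2,3) 7(2) jR inpD(1)[OF s1(1)]
        by (intro run_Seq run_NAssign run_Cond run_Skip)
          (auto simp: atLeastAtMostSuc_conv)
    qed (use inpD(1)[OF s1(1)] N in auto)
  next
    assume "\<not> bval (NLess (NConst 0) (arr a (V 10))) s1"
    then have "Suc k \<notin> ?R" using 7(3) s1 j act by simp
    then show "run N SKIP s1 (\<lambda>s'.
      nats s' (13, 0, 0) = 0 \<and> (\<forall>j\<in>?R \<inter> {1..Suc k}. nats s' (5, j, 0) \<in> ?R \<and> envies s (nats s' (5, j, 0)) j) \<or>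
      nats s' (13, 0, 0) \<in> ?R \<and> (\<forall>i\<in>?R. \<not> envies s i (nats s' (13, 0, 0))))"
      using 7(2) by (intro run_Skip) (auto simp: atLeastAtMostSuc_conv)
  qed
next
  case (8 s')
  have "reals s' = reals s" using same_reals[OF 8(2)] by (auto simp: fun_eq_iff)
  moreover have "active a s \<subseteq> {1..n}" by (auto simp: active_def)
  ultimately show ?case using 8(1) inpD(1)[OF inp] by (auto simp: Int_absorb2)
qed (use inpD(1)[OF inp] N in auto)

text \<open>A deleted agent is envied by no active agent, so a set whose members are all envied from
  within never loses its first member. Hence an empty result proves acyclicity, and a nonempty one
  comes with predecessors to follow.\<close>

lemma run_core:
  assumes inp: "inp s"
  shows "run N core_prog s (\<lambda>s'. active 4 s' \<subseteq> active 3 s \<and>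
     (\<forall>j\<in>active 4 s'. pred_ok (active 4 s') s' j) \<and>
     (\<forall>D \<subseteq> active 3 s. (\<forall>j\<in>D. \<exists>i\<in>D. envies s i j) \<longrightarrow> D \<subseteq> active 4 s'))"
  unfolding core_prog_def
proof (intro run_Seq, rule run_For[where I = "\<lambda>k s'. \<forall>j\<in>{1..k}. nats s' (4, j, 0) = nats s (3, j, 0)"], goal_cases)
  case (7 k s')
  then show ?case using same_nats[OF 7(4)] by (intro run_NAssign) (auto simp: atLeastAtMostSuc_conv)
next
  case (8 s1)
  have s1: "inp s1" "active 4 s1 = active 3 s" "\<And>i j. reals s1 (3, i, j) = reals s (3, i, j)"
    using inp_same[OF 8(2) inp] same_reals[OF 8(2)] 8(1) inpD(1)[OF inp] by (auto simp: active_def)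
  let ?I = "\<lambda>k s'. active 4 s' \<subseteq> active 3 s \<and>
     (\<forall>D \<subseteq> active 3 s. (\<forall>j\<in>D. \<exists>i\<in>D. envies s i j) \<longrightarrow> D \<subseteq> active 4 s') \<and>
     (\<forall>i j. reals s' (3, i, j) = reals s (3, i, j)) \<and>
     (card (active 4 s') \<le> n - k \<or> (\<forall>j\<in>active 4 s'. pred_ok (active 4 s') s' j))"
  show ?case
  proof (rule run_For[where I = ?I], goal_cases)
    case 5
    have "card (active 3 s) \<le> card {1..n}" by (rule card_mono) (auto simp: active_def)
    then show ?case using s1 by simp
  next
    case (6 k s' j)
    have "active 4 (s'\<lparr>nats := (nats s')((12, 0, 0) := j)\<rparr>) = active 4 s'" by (simp add: active_def)
    then show ?case using 6 by auto
  next
    case (7 k s2)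
    have s2: "inp s2" using inp_same[OF 7(4) s1(1)] by simp
    show ?case
    proof (rule run_Seq[OF run_frame[OF run_source[OF s2]]])
      fix s3 assume s3: "same (nat_arrays (source_prog 4)) (real_arrays (source_prog 4)) s2 s3"
        and r: "nats s3 (13, 0, 0) = 0 \<and> (\<forall>j\<in>active 4 s2. pred_ok (active 4 s2) s3 j) \<or>
          nats s3 (13, 0, 0) \<in> active 4 s2 \<and> (\<forall>i\<in>active 4 s2. \<not> envies s2 i (nats s3 (13, 0, 0)))"
      have a3: "active 4 s3 = active 4 s2" "\<And>i j. reals s3 (3, i, j) = reals s (3, i, j)"
        using state_same(3)[OF s3] same_reals[OF s3] 7(2) by auto
      let ?r = "nats s3 (13, 0, 0)"
      let ?s = "s3\<lparr>nats := (nats s3)((4, ?r, 0) := 0)\<rparr>"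
      have a: "active 4 ?s = active 4 s2 - {?r}" unfolding a3(1)[symmetric] by (auto simp: active_def)
      have fin: "finite (active 4 s2)" by (simp add: active_def)
      have D: "D \<subseteq> active 4 ?s" if D: "D \<subseteq> active 3 s" "\<forall>j\<in>D. \<exists>i\<in>D. envies s i j" for D
      proof -
        have sub: "D \<subseteq> active 4 s2" using 7(2) D by blast
        have "?r \<notin> D"
        proof
          assume "?r \<in> D"
          then obtain i where i: "i \<in> D" "envies s i ?r" using D by blast
          have "?r \<noteq> 0" using \<open>?r \<in> D\<close> D by (auto simp: active_def)
          then have "\<not> envies s2 i ?r" using r i sub by auto
          then show False using i 7(2) by simp
        qed
        then show ?thesis using sub a by blast
      qed
      moreover have "card (active 4 ?s) \<le> n - Suc k \<or> (\<forall>j\<in>active 4 ?s. pred_ok (active 4 ?s) ?s j)"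
        using r
      proof
        assume r0: "?r = 0 \<and> (\<forall>j\<in>active 4 s2. pred_ok (active 4 s2) s3 j)"
        then have "active 4 ?s = active 4 s2" unfolding a by (auto simp: active_def)
        then show ?thesis using r0 by simp
      next
        assume r1: "?r \<in> active 4 s2 \<and> (\<forall>i\<in>active 4 s2. \<not> envies s2 i ?r)"
        \<comment> \<open>Had predecessors been complete already, the agent found would be envied by
          its own predecessor; so the other alternative of the invariant holds.\<close>
        then have "card (active 4 s2) \<le> n - k" using 7(2) by metis
        moreover have "card (active 4 ?s) = card (active 4 s2) - 1" unfolding a using r1 fin by simp
        ultimately have "card (active 4 ?s) \<le> n - Suc k" by linarith
        then show ?thesis by (rule disjI1)
      qed
      moreover have "active 4 ?s \<subseteq> active 3 s" using a 7(2) by blast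
      moreover have "\<forall>i j. reals ?s (3, i, j) = reals s (3, i, j)" using a3 by simp
      ultimately have "?I (Suc k) ?s" by blast
      then show "run N (NAssign 4 (V 13) (NConst 0) (NConst 0)) s3 (?I (Suc k))"
        by (intro run_NAssign) (unfold nval.simps)
    qed simp
  next
    case (8 s')
    have n: "nats s1 (0, 0, 0) = n" using inpD(1)[OF s1(1)] .
    have fin: "finite (active 4 s')" by (simp add: active_def)
    have "\<forall>j\<in>active 4 s'. pred_ok (active 4 s') s' j"
      using 8(1) fin unfolding n by auto
    then show ?case using 8(1) by blast
  qed (use inpD(1)[OF s1(1)] N in auto)
qed (use inpD(1)[OF inp] N in auto)

end

section \<open>Programs for rotations, the two cases and the main loop\<close>

definition rotate_prog :: com where
  "rotate_prog = Seq (For 10 0 (set_nat 16 (arr 5 (V 16))))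
     (Seq (NAssign 6 (NConst 0) (NConst 0) (NConst 0))
     (Seq (For 10 0 (NAssign 6 (V 10) (NConst 0) (V 10)))
     (Seq (For 10 0 (Seq (NAssign 6 (V 16) (NConst 0) (arr 5 (V 16))) (set_nat 16 (arr 5 (V 16)))))
       (For 10 1 (NAssign 2 (V 10) (NConst 0) (arr 6 (arr 2 (V 10))))))))"

definition resolve_prog :: com where
  "resolve_prog = Seq (set_nat 15 (NConst 1)) (While (NLess (NConst 0) (V 15))
     (Seq value_prog (Seq core_prog (Seq (Find 16 10 0 (NLess (NConst 0) (arr 4 (V 10))))
       (Cond (NLess (NConst 0) (V 16)) rotate_prog (set_nat 15 (NConst 0)))))))"

text \<open>Here \<open>r\<close> is the squared ratio of the base values of the candidate and of
  the selected good; \<open>near_test\<close> justifies the comparison.\<close>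

definition near_exp :: bexp where
  "near_exp = (let r = RDiv (RVar 1 (V 10) (NConst 0)) (RVar 1 (V 7) (NConst 0));
     q = RSub (RAdd (RConst 1) (RS 2)) r in BNot (RLess r (RMul q q)))"

definition if_prog :: com where
  "if_prog = Seq (Best 9 10 1 (BAnd (BNot (NLess (NConst 0) (arr 2 (V 10)))) near_exp) (\<lambda>w. RVar 0 (V 8) (V w)))
     (Seq (NAssign 2 (V 9) (NConst 0) (V 8)) (NAssign 3 (V 8) (NConst 0) (NConst 1)))"

definition else_prog :: com where
  "else_prog = Seq resolve_prog (Seq (source_prog 3) (NAssign 2 (V 7) (NConst 0) (V 13)))"

definition body_prog :: com where
  "body_prog = Seq (Best 7 10 1 (BNot (NLess (NConst 0) (arr 2 (V 10)))) (\<lambda>w. RVar 1 (V w) (NConst 0)))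
     (Seq (Find 8 10 0 (BAnd (BNot (NLess (NConst 0) (arr 3 (V 10)))) (RLess (RConst 0) (RVar 0 (V 10) (V 7)))))
       (Cond (NLess (NConst 0) (V 8)) if_prog else_prog))"

text \<open>Every round assigns exactly one good, so the loop over unassigned goods becomes a
  counted loop with \<open>m\<close> rounds.\<close>

definition labase_prog :: com where
  "labase_prog = Seq base_prog (For 17 1 body_prog)"

lemma arrays_progs2 [simp]:
  "nat_arrays rotate_prog = {2, 6, 10, 16}" "real_arrays rotate_prog = {}"
  "nat_arrays resolve_prog = {2, 4, 5, 6, 10, 11, 12, 13, 14, 15, 16}" "real_arrays resolve_prog = {3}"
  "nat_arrays if_prog = {2, 3, 9, 10}" "real_arrays if_prog = {}"
  "nat_arrays else_prog = {2, 4, 5, 6, 10, 11, 12, 13, 14, 15, 16}" "real_arrays else_prog = {3}"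
  "nat_arrays body_prog = {2, 3, 4, 5, 6, 7, 8, 9, 10, 11, 12, 13, 14, 15, 16}" "real_arrays body_prog = {3}"
  by (auto simp: rotate_prog_def resolve_prog_def if_prog_def else_prog_def body_prog_def)

section \<open>Simulation of the transition system in memory\<close>

context fd_program
begin

abbreviation reach :: "config \<Rightarrow> bool" where
  "reach \<equiv> (labase_step n m v)\<^sup>*\<^sup>* (labase_init n m)"

abbreviation loop_state :: "mem \<Rightarrow> config" where
  "loop_state s \<equiv> Loop (bundles s) (unassigned s) (empty_agents s)"

abbreviation resolve_state :: "nat \<Rightarrow> mem \<Rightarrow> config" where
  "resolve_state g s \<equiv> Resolve (bundles s) (unassigned s) (empty_agents s) g"

abbreviation envy :: "mem \<Rightarrow> (nat \<times> nat) set" where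
  "envy s \<equiv> envy_graph v ({1..n} - empty_agents s) (bundles s)"

lemma nonempty_agents: "{1..n} - empty_agents s = active 3 s"
  by (auto simp: empty_agents_def active_def)

lemma envy_iff: "values_ok s \<Longrightarrow> (i, j) \<in> envy s \<longleftrightarrow> i \<in> active 3 s \<and> j \<in> active 3 s \<and> envies s i j"
  unfolding nonempty_agents by (auto simp: envy_graph_def values_ok_def active_def)

text \<open>The table of new owners in a rotation is initialised on 0 to \<open>n\<close> only, so
  an owner beyond \<open>n\<close> would read a meaningless entry.\<close>

lemma owner_le:
  assumes "state_inv (bundles s) U Z" "U = unassigned s" "g \<in> {1..m}"
  shows "nats s (2, g, 0) \<le> n"
proof (cases "nats s (2, g, 0) = 0")
  case False
  then have "g \<notin> unassigned s" by (simp add: unassigned_def output_bundles_def)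
  then obtain i where "i \<in> {1..n}" "g \<in> bundles s i"
    using state_invD(4)[OF assms(1)] assms(2,3) by blast
  then show ?thesis by (simp add: bundles_def output_bundles_def split: if_splits)
qed simp

text \<open>The first \<open>n\<close> predecessor steps reach a cycle, the next \<open>n\<close>
  write the new owners along it. The bundle of an agent goes to its predecessor, who envies
  it.\<close>

lemma run_rotate:
  fixes s :: mem and E :: "(nat \<times> nat) set"
  defines "p \<equiv> \<lambda>j. nats s (5, j, 0)"
  assumes inp: "inp s" and R: "R \<subseteq> {1..n}" and x: "nats s (16, 0, 0) \<in> R"
    and p: "\<And>j. j \<in> R \<Longrightarrow> p j \<in> R" "\<And>j. j \<in> R \<Longrightarrow> (p j, j) \<in> E"
    and own: "\<And>g. g \<in> {1..m} \<Longrightarrow> nats s (2, g, 0) \<le> n"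
  shows "run N rotate_prog s (\<lambda>s'. (\<exists>c. simple_cycle E c \<and> rotate_bundles c (bundles s) (bundles s')) \<and>
    unassigned s' = unassigned s)"
proof -
  define x where "x = nats s (16, 0, 0)"
  define y where "y = (p ^^ n) x"
  have fin: "finite R" "card R \<le> n"
    using R finite_subset card_mono[OF _ R] by auto
  obtain c where c: "simple_cycle E c" "set c = (\<lambda>k. (p ^^ k) y) ` {..<n}" "set c \<subseteq> R"
    "\<And>t. t < length c \<Longrightarrow> p (c ! ((t + 1) mod length c)) = c ! t"
    using predecessor_cycle[OF fin, of x p E] p assms(4) unfolding y_def x_def by metis
  \<comment> \<open>The new owner as a function of the old one. It fixes 0, which is not on the
    cycle, so unassigned goods stay unassigned.\<close>
  define q where "q z = (if z \<in> set c then p z else z)" for z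
  have len: "0 < length c" and dist: "distinct c" using c(1) by (auto simp: simple_cycle_def)
  have ex: "\<exists>t < length c. u = c ! ((t + 1) mod length c)" if u: "u \<in> set c" for u
  proof -
    obtain w where w: "w < length c" "u = c ! w" using u by (auto simp: in_set_conv_nth)
    show ?thesis
    proof (cases w)
      case 0
      then show ?thesis using w len by (intro exI[of _ "length c - 1"]) simp
    next
      case (Suc w')
      then show ?thesis using w by (intro exI[of _ w']) simp
    qed
  qed
  have q_cycle: "q u = c ! t \<longleftrightarrow> u = c ! ((t + 1) mod length c)" if t: "t < length c" for u t
  proof
    assume "u = c ! ((t + 1) mod length c)"
    then show "q u = c ! t" using c(4)[OF t] len by (simp add: q_def)
  next
    assume eq: "q u = c ! t"
    have "u \<in> set c" using eq t by (auto simp: q_def split: if_splits)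
    then obtain t' where t': "t' < length c" "u = c ! ((t' + 1) mod length c)" using ex by blast
    then have "c ! t' = c ! t" using eq \<open>u \<in> set c\<close> c(4) by (simp add: q_def)
    then show "u = c ! ((t + 1) mod length c)" using t t' dist by (simp add: nth_eq_iff_index_eq)
  qed
  have q_other: "q u = i \<longleftrightarrow> u = i" if i: "i \<notin> set c" for u i
  proof (cases "u \<in> set c")
    case True
    then obtain t' where "t' < length c" "u = c ! ((t' + 1) mod length c)" using ex by blast
    then have "p u \<in> set c" using c(4) by simp
    then show ?thesis using True i by (auto simp: q_def)
  qed (use i in \<open>auto simp: q_def\<close>)
  have post: "(\<exists>c. simple_cycle E c \<and> rotate_bundles c (bundles s) (bundles s')) \<and> unassigned s' = unassigned s"
    if s': "\<And>g. g \<in> {1..m} \<Longrightarrow> nats s' (2, g, 0) = q (nats s (2, g, 0))" for s'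
  proof -
    have ob: "output_bundles m s' i = {g \<in> {1..m}. q (nats s (2, g, 0)) = i}" for i
      using s' by (auto simp: output_bundles_def)
    have same: "output_bundles m s' i = output_bundles m s i" if "i \<notin> set c" for i
      unfolding ob q_other[OF that] by (simp add: output_bundles_def)
    have cyc: "output_bundles m s' (c ! t) = output_bundles m s (c ! ((t + 1) mod length c))" if "t < length c" for t
      unfolding ob q_cycle[OF that] by (simp add: output_bundles_def)
    have pos: "c ! t \<noteq> 0" if "t < length c" for t using c(3) R nth_mem[OF that] by fastforce
    have "rotate_bundles c (bundles s) (bundles s')"
      unfolding rotate_bundles_def
    proof (intro conjI allI impI)
      show "bundles s' (c ! t) = bundles s (c ! ((t + 1) mod length c))" if "t < length c" for t
        using cyc[OF that] pos[OF that] pos[of "(t + 1) mod length c"] len by (simp add: bundles_def)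
      show "bundles s' i = bundles s i" if "i \<notin> set c" for i
        using same[OF that] by (simp add: bundles_def)
    qed
    moreover have "0 \<notin> set c" using c(3) R by auto
    ultimately show ?thesis using c(1) same by (auto simp: unassigned_def)
  qed
  have n: "\<And>s'. inp s' \<Longrightarrow> nats s' (0, 0, 0) = n" "\<And>s'. inp s' \<Longrightarrow> nats s' (1, 0, 0) = m" using inpD by auto
  show ?thesis
    unfolding rotate_prog_def
  proof (rule run_Seq, rule run_For[where I = "\<lambda>k s'. nats s' (16, 0, 0) = (p ^^ k) x"], goal_cases)
    case (7 k s')
    then show ?case using same_nats[OF 7(4)] by (intro run_NAssign) (simp add: p_def)
  next
    case (8 s1)
    have in1: "inp s1" using inp_same[OF 8(2) inp] by simp
    have y: "nats s1 (16, 0, 0) = y" using 8(1) n inp by (simp add: y_def)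
    let ?s1 = "s1\<lparr>nats := (nats s1)((6, nval (NConst 0) s1, nval (NConst 0) s1) := nval (NConst 0) s1)\<rparr>"
    have in1': "inp ?s1" using in1 by (simp add: inp_def)
    show ?case
    proof (rule run_Seq, rule run_NAssign, rule run_Seq,
      rule run_For[where I = "\<lambda>k s'. \<forall>j\<in>{0..k}. nats s' (6, j, 0) = j"], goal_cases)
      case (7 k s')
      then show ?case by (intro run_NAssign) (auto simp: atLeastAtMostSuc_conv)
    next
      case (8 s2)
      have in2: "inp s2" using inp_same[OF 8(2) in1'] by simp
      have s2: "nats s2 (16, 0, 0) = y" "\<And>j. nats s2 (5, j, 0) = p j" "\<And>g. nats s2 (2, g, 0) = nats s (2, g, 0)"
        using same_nats[OF 8(2)] same_nats[OF \<open>same _ _ s s1\<close>] y by (auto simp: p_def)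
      \<comment> \<open>Going \<open>n\<close> steps covers the whole cycle; further rounds write
        the same entries again.\<close>
      let ?I = "\<lambda>k s'. nats s' (16, 0, 0) = (p ^^ k) y \<and>
        (\<forall>z\<in>{0..n}. nats s' (6, z, 0) = (if z \<in> (\<lambda>k. (p ^^ k) y) ` {..<k} then p z else z))"
      show ?case
      proof (rule run_Seq, rule run_For[where I = ?I], goal_cases)
        case 5
        then show ?case using 8(1) s2 n in1 by simp
      next
        case (7 k s')
        have "nats s' (5, j, 0) = p j" for j using same_nats[OF 7(4)] s2 by simp
        then show ?case using 7(2) by (intro run_Seq run_NAssign) (auto simp: lessThan_Suc)
      next
        case (8 s3)
        have in3: "inp s3" using inp_same[OF 8(2) in2] by simp
        have s3: "nats s3 (2, g, 0) = nats s (2, g, 0)" for g using same_nats[OF 8(2)] s2 by simp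
        have q3: "nats s3 (6, z, 0) = q z" if "z \<le> n" for z
          using 8(1) that n[OF in2] by (simp add: q_def c(2))
        let ?J = "\<lambda>k s'. (\<forall>g\<in>{1..k}. nats s' (2, g, 0) = q (nats s (2, g, 0))) \<and>
          (\<forall>g>k. nats s' (2, g, 0) = nats s (2, g, 0))"
        show ?case
        proof (rule run_For[where I = ?J], goal_cases)
          case (7 k s')
          have "nats s' (6, z, 0) = q z" if "z \<le> n" for z using same_nats[OF 7(4)] q3 that by simp
          moreover have "nats s (2, Suc k, 0) \<le> n" using own 7(1) n[OF in3] by simp
          ultimately show ?case using 7(2,3) by (intro run_NAssign) (auto simp: atLeastAtMostSuc_conv)
        next
          case (8 s4)
          then show ?case using post n[OF in3] by blast
        qed (use s3 n[OF in3] N in auto)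
      qed (use n[OF in2] N in auto)
    qed (use n[OF in1] N in auto)
  qed (use n[OF inp] N x_def in auto)
qed

lemma run_resolve:
  assumes inp: "inp s" and reach: "reach (resolve_state g s)"
  shows "run N resolve_prog s (\<lambda>s'. reach (resolve_state g s') \<and> unassigned s' = unassigned s \<and>
    acyclic (envy s') \<and> values_ok s')"
  unfolding resolve_prog_def
proof (intro run_Seq run_NAssign)
  let ?s = "s\<lparr>nats := (nats s)((15, nval (NConst 0) s, nval (NConst 0) s) := nval (NConst 1) s)\<rparr>"
  let ?I = "\<lambda>s'. inp s' \<and> reach (resolve_state g s') \<and> unassigned s' = unassigned s \<and>
    (nats s' (15, 0, 0) = 0 \<longrightarrow> acyclic (envy s') \<and> values_ok s')"
  \<comment> \<open>The extra 1 makes lowering the flag count as progress even when no envy edge is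
    left.\<close>
  let ?\<mu> = "\<lambda>s'. if nats s' (15, 0, 0) = 0 then 0 else 1 + card (envy s')"
  have same: "same {15} {} s ?s" by (simp add: same_def)
  have card: "card (envy s') \<le> n * n" for s' by (rule card_envy_graph_le) simp
  let ?c = "Seq value_prog (Seq core_prog (Seq (Find 16 10 0 (NLess (NConst 0) (arr 4 (V 10))))
       (Cond (NLess (NConst 0) (V 16)) rotate_prog (set_nat 15 (NConst 0)))))"
  show "run N (While (NLess (NConst 0) (V 15)) ?c) ?s (\<lambda>s'. reach (resolve_state g s') \<and>
    unassigned s' = unassigned s \<and> acyclic (envy s') \<and> values_ok s')"
  proof (rule run_While[where I = ?I and \<mu> = ?\<mu>])
    show "?I ?s" using state_same[OF same] inp_same[OF same inp] reach by simp
    show "?\<mu> ?s \<le> N" using card[of ?s] N by simp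
  next
    fix s1 assume I: "?I s1" and b: "bval (NLess (NConst 0) (V 15)) s1"
    then have in1: "inp s1" and flag: "nats s1 (15, 0, 0) \<noteq> 0" by auto
    have inv: "state_inv (bundles s1) (unassigned s1) (empty_agents s1)"
      using I config_inv_steps by force
    show "run N ?c s1 (\<lambda>s'. ?I s' \<and> ?\<mu> s' < ?\<mu> s1)"
    proof (rule run_Seq[OF run_frame[OF run_value[OF in1]]])
      fix s2 assume s2: "same (nat_arrays value_prog) (real_arrays value_prog) s1 s2" "values_ok s2"
      have in2: "inp s2" using inp_same[OF s2(1) in1] by simp
      show "run N (Seq core_prog (Seq (Find 16 10 0 (NLess (NConst 0) (arr 4 (V 10))))
       (Cond (NLess (NConst 0) (V 16)) rotate_prog (set_nat 15 (NConst 0))))) s2 (\<lambda>s'. ?I s' \<and> ?\<mu> s' < ?\<mu> s1)"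
      proof (rule run_Seq[OF run_frame[OF run_core[OF in2]]])
        fix s3 assume same3: "same (nat_arrays core_prog) (real_arrays core_prog) s2 s3"
          and core: "active 4 s3 \<subseteq> active 3 s2 \<and>
            (\<forall>j\<in>active 4 s3. pred_ok (active 4 s3) s3 j) \<and>
            (\<forall>D \<subseteq> active 3 s2. (\<forall>j\<in>D. \<exists>i\<in>D. envies s2 i j) \<longrightarrow> D \<subseteq> active 4 s3)"
        have in3: "inp s3" using inp_same[OF same3 in2] by simp
        show "run N (Seq (Find 16 10 0 (NLess (NConst 0) (arr 4 (V 10))))
          (Cond (NLess (NConst 0) (V 16)) rotate_prog (set_nat 15 (NConst 0)))) s3 (\<lambda>s'. ?I s' \<and> ?\<mu> s' < ?\<mu> s1)"
        proof (rule run_Seq, rule run_Find[where P = "\<lambda>j. j \<in> active 4 s3"], goal_cases)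
          case (5 s' j)
          then show ?case using same_nats[OF 5(1)] inpD(1)[OF in3] by (simp add: active_def)
        next
          case (6 s4 r)
          have in4: "inp s4" using inp_same[OF 6(1) in3] by simp
          have eq4: "bundles s4 = bundles s1" "unassigned s4 = unassigned s1" "empty_agents s4 = empty_agents s1"
            "active 3 s4 = active 3 s1" "active 4 s4 = active 4 s3" "active 3 s2 = active 3 s1"
            using state_same[OF 6(1)] state_same[OF same3] state_same[OF s2(1)] by auto
          have flag4: "nats s4 (15, 0, 0) = nats s1 (15, 0, 0)"
            using same_nats[OF 6(1)] same_nats[OF same3] same_nats[OF s2(1)] by simp
          have re: "reals s4 (3, i, j) = reals s2 (3, i, j)" "reals s3 (3, i, j) = reals s2 (3, i, j)" for i j
            using same_reals[OF 6(1)] same_reals[OF same3] by auto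
          have vals4: "values_ok s4"
            using values_same[OF 6(1)] values_same[OF same3] s2(2) by simp
          have p4: "nats s4 (5, j, 0) = nats s3 (5, j, 0)" for j using same_nats[OF 6(1)] by simp
          show ?case
          proof (rule run_Cond)
            assume "bval (NLess (NConst 0) (V 16)) s4"
            then have r: "nats s4 (16, 0, 0) \<in> active 4 s3" using 6(2,3) by auto
            have R: "active 4 s3 \<subseteq> {1..n}" by (auto simp: active_def)
            have own: "nats s4 (2, g, 0) \<le> n" if "g \<in> {1..m}" for g
              using owner_le[of s4] inv that unfolding eq4 by blast
            have pr: "nats s4 (5, j, 0) \<in> active 4 s3" if "j \<in> active 4 s3" for j
              using core that unfolding p4 by blast
            have pe: "(nats s4 (5, j, 0), j) \<in> envy s4" if j: "j \<in> active 4 s3" for j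
            proof -
              have "envies s4 (nats s4 (5, j, 0)) j" using core j unfolding p4 re by blast
              moreover have "nats s4 (5, j, 0) \<in> active 3 s4" "j \<in> active 3 s4"
                using pr[OF j] j core unfolding eq4 by blast+
              ultimately show ?thesis unfolding envy_iff[OF vals4] by blast
            qed
            show "run N rotate_prog s4 (\<lambda>s'. ?I s' \<and> ?\<mu> s' < ?\<mu> s1)"
            proof (rule run_frame[OF run_rotate[OF in4 R r pr pe own]])
              fix s5 assume s5: "same (nat_arrays rotate_prog) (real_arrays rotate_prog) s4 s5"
                and "(\<exists>c. simple_cycle (envy s4) c \<and> rotate_bundles c (bundles s4) (bundles s5)) \<and>
                  unassigned s5 = unassigned s4"
              then obtain c where c: "simple_cycle (envy s4) c" "rotate_bundles c (bundles s4) (bundles s5)"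
                and u: "unassigned s5 = unassigned s4" by blast
              have e: "empty_agents s5 = empty_agents s4" using state_same(4)[OF s5] by simp
              have "labase_step n m v (resolve_state g s4) (resolve_state g s5)"
                unfolding u e using rotate[OF c] .
              moreover have "reach (resolve_state g s4)" unfolding eq4 using I by blast
              ultimately have "reach (resolve_state g s5)" by (rule rtranclp.rtrancl_into_rtrancl[rotated])
              moreover have "card (envy s5) < card (envy s4)"
                unfolding e by (rule rotation_decreases_envy[OF _ c]) simp
              moreover have "envy s4 = envy s1" unfolding eq4 ..
              moreover have "nats s5 (15, 0, 0) = nats s1 (15, 0, 0)"
                using same_nats[OF s5] flag4 by simp
              moreover have "inp s5" using inp_same[OF s5 in4] by simp
              ultimately show "?I s5 \<and> ?\<mu> s5 < ?\<mu> s1" using flag u eq4 I by simp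
            qed
          next
            assume "\<not> bval (NLess (NConst 0) (V 16)) s4"
            then have empty: "active 4 s3 = {}"
              using 6(2,3) inpD(1)[OF in3] by (auto simp: active_def)
            \<comment> \<open>Any set whose members are all envied from within would have survived
              the deletions, and nothing survived.\<close>
            have ac: "acyclic (envy s4)"
            proof (rule acyclicI_no_core[where N = "active 3 s4"])
              show "envy s4 \<subseteq> active 3 s4 \<times> active 3 s4" using envy_iff[OF vals4] by auto
              show "D = {}" if D: "D \<subseteq> active 3 s4" "\<forall>j\<in>D. \<exists>i\<in>D. (i, j) \<in> envy s4" for D
              proof -
                have "\<forall>j\<in>D. \<exists>i\<in>D. envies s2 i j" using D(2) unfolding envy_iff[OF vals4] re by blast
                then have "D \<subseteq> active 4 s3" using core D(1) unfolding eq4 by blast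
                then show ?thesis using empty by blast
              qed
            qed
            let ?s5 = "s4\<lparr>nats := (nats s4)((15, 0, 0) := 0)\<rparr>"
            have s5: "same {15} {} s4 ?s5" by (simp add: same_def)
            have eq5: "bundles ?s5 = bundles s4" "unassigned ?s5 = unassigned s4" "empty_agents ?s5 = empty_agents s4"
              using state_same[OF s5] by auto
            have "values_ok ?s5" using values_same[OF s5] vals4 by simp
            moreover have "inp ?s5" using inp_same[OF s5] in4 by simp
            moreover have "reach (resolve_state g ?s5)" unfolding eq5 eq4 using I by blast
            moreover have "acyclic (envy ?s5)" unfolding eq5 using ac .
            moreover have "unassigned ?s5 = unassigned s" unfolding eq5 eq4 using I by blast
            ultimately have "?I ?s5 \<and> ?\<mu> ?s5 < ?\<mu> s1" using flag by force
            show "run N (set_nat 15 (NConst 0)) s4 (\<lambda>s'. ?I s' \<and> ?\<mu> s' < ?\<mu> s1)"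
              by (rule run_NAssign, unfold nval.simps, fact)
          qed
        qed (use inpD(1)[OF in3] N in auto)
      qed
    qed
  qed auto
qed

text \<open>Since \<open>\<eta>\<^sup>2 + \<eta> = 1 + \<gamma>\<close>, the test \<open>y \<ge> \<eta>\<close> for \<open>y = bv h / bv g\<close> is \<open>y \<ge> 1 + \<gamma> - y\<^sup>2\<close>,
  which can be squared because the right-hand side is positive; only \<open>y\<^sup>2\<close> is computable without roots.\<close>

lemma near_test:
  assumes "0 < b" "0 \<le> a" "a \<le> b"
  shows "\<eta> * b \<le> a \<longleftrightarrow> \<not> a\<^sup>2 / b\<^sup>2 < (1 + \<gamma> - a\<^sup>2 / b\<^sup>2) * (1 + \<gamma> - a\<^sup>2 / b\<^sup>2)"
proof -
  define y where "y = a / b"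
  have y: "0 \<le> y" "y \<le> 1" using assms by (auto simp: y_def)
  have sq: "a\<^sup>2 / b\<^sup>2 = y\<^sup>2" by (simp add: y_def power_divide)
  have "y\<^sup>2 \<le> 1" using y by (simp add: power_le_one)
  then have pos: "0 \<le> 1 + \<gamma> - y\<^sup>2" using range_pos by simp
  have "\<eta> * b \<le> a \<longleftrightarrow> \<eta> \<le> y" using assms by (simp add: y_def field_simps)
  also have "\<dots> \<longleftrightarrow> \<eta>\<^sup>2 + \<eta> \<le> y\<^sup>2 + y"
  proof
    assume "\<eta> \<le> y"
    then show "\<eta>\<^sup>2 + \<eta> \<le> y\<^sup>2 + y" using eta_pos by (intro add_mono power_mono) auto
  next
    assume le: "\<eta>\<^sup>2 + \<eta> \<le> y\<^sup>2 + y"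
    show "\<eta> \<le> y"
    proof (rule ccontr)
      assume "\<not> \<eta> \<le> y"
      then have "y\<^sup>2 + y < \<eta>\<^sup>2 + \<eta>" using y by (intro add_le_less_mono power_mono) auto
      then show False using le by simp
    qed
  qed
  also have "\<dots> \<longleftrightarrow> 1 + \<gamma> - y\<^sup>2 \<le> y" using eta_eq by linarith
  also have "\<dots> \<longleftrightarrow> (1 + \<gamma> - y\<^sup>2)\<^sup>2 \<le> y\<^sup>2" using pos y by (simp add: power2_le_iff_abs_le)
  finally show ?thesis unfolding sq by (simp add: power2_eq_square not_less)
qed

section \<open>One round of the main loop\<close>

lemma assign_good:
  assumes g: "g \<in> unassigned s" and i: "i \<noteq> 0"
    and s': "\<And>h. nats s' (2, h, 0) = (if h = g then i else nats s (2, h, 0))"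
  shows "bundles s' = (bundles s)(i := insert g (bundles s i))" "unassigned s' = unassigned s - {g}"
  using g i by (auto simp: fun_eq_iff bundles_def unassigned_def output_bundles_def s')

lemma finite_unassigned: "finite (unassigned s)"
  by (simp add: unassigned_def output_bundles_def)

lemma run_if:
  assumes inp: "inp s" and base: "base_ok s" and reach: "reach (loop_state s)"
    and g: "nats s (7, 0, 0) = g" "is_arg_max bv (\<lambda>h. h \<in> unassigned s) g"
    and i: "nats s (8, 0, 0) = i" "i \<in> empty_agents s" "v i g > 0"
  shows "run N if_prog s (\<lambda>s'. reach (loop_state s') \<and> card (unassigned s') = card (unassigned s) - 1)"
  unfolding if_prog_def
proof (rule run_Seq, rule run_Best[where P = "\<lambda>j. j \<in> near_top n m v (unassigned s)"
    and F = "\<lambda>j. if j \<in> {1..m} then v i j else 0"], goal_cases)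
  note inv = config_inv_steps[OF reach, simplified]
  have i_n: "i \<in> {1..n}" using i state_invD(1)[OF inv] by blast
  have U: "unassigned s \<subseteq> {1..m}" using state_invD(2)[OF inv] .
  have g_m: "g \<in> {1..m}" using g U by (auto simp: is_arg_max_def)
  {
    case (5 j)
    then show ?case using v_nonneg[OF i_n] by simp
  next
    case (6 s' j)
    have j: "j \<in> {1..m}" using 6(3) inpD(2)[OF inp] by simp
    have rd: "nats s' (10, 0, 0) = j" "nats s' (2, j, 0) = nats s (2, j, 0)" "nats s' (7, 0, 0) = g"
      "reals s' (1, j, 0) = (bv j)\<^sup>2" "reals s' (1, g, 0) = (bv g)\<^sup>2" "reals s' (2, 0, 0) = \<gamma>"
      using 6(1,2) same_nats[OF 6(1)] same_reals[OF 6(1)] base j g_m g(1) by (auto simp: base_ok_def)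
    have un: "j \<in> unassigned s \<longleftrightarrow> nats s (2, j, 0) = 0" using j by (simp add: unassigned_def output_bundles_def)
    have "near_top n m v (unassigned s) = {h \<in> unassigned s. \<eta> * bv g \<le> bv h}"
      using near_top_arg_max(1)[OF U g(2)] by blast
    moreover have "\<eta> * bv g \<le> bv j \<longleftrightarrow> bval near_exp s'" if "j \<in> unassigned s"
      using near_test[of "bv g" "bv j"] base_value_pos[OF g_m] base_value_pos[OF j] arg_max_ge[OF g(2) that]
      by (simp add: near_exp_def Let_def rd del: One_nat_def)
    ultimately show ?case using rd un by auto
  next
    \<comment> \<open>The index \<open>w\<close> may still hold 0; the input array is 0 there, in
      agreement with \<open>F\<close>.\<close>
    case (7 s' w)
    then show ?case using i inpD(2)[OF inp] i_n same_nats[OF 7(1), of 8] inp_same[OF 7(1) inp]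
      by (auto simp: inp_def)
  next
    case (8 s1 f)
    have "g \<in> near_top n m v (unassigned s)" using near_top_arg_max(2)[OF U g(2)] .
    then have f: "f \<in> {1..m}" "f \<in> near_top n m v (unassigned s)"
      and max: "\<And>j. j \<in> {1..m} \<Longrightarrow> j \<in> near_top n m v (unassigned s) \<Longrightarrow> v i j \<le> v i f"
      using 8(3) g_m inpD(2)[OF inp] by auto
    have top_U: "near_top n m v (unassigned s) \<subseteq> unassigned s" by (auto simp: near_top_def)
    have f_max: "is_arg_max (v i) (\<lambda>h. h \<in> near_top n m v (unassigned s)) f"
      using f max top_U U by (auto simp: is_arg_max_def not_less)
    have f_U: "f \<in> unassigned s" using f top_U by blast
    let ?s2 = "s1\<lparr>nats := (nats s1)((2, f, 0) := i)\<rparr>"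
    let ?s3 = "?s2\<lparr>nats := (nats ?s2)((3, i, 0) := 1)\<rparr>"
    have i1: "nats s1 (8, 0, 0) = i" using same_nats[OF 8(1), of 8] i by simp
    have own: "nats ?s3 (2, h, 0) = (if h = f then i else nats s (2, h, 0))" for h
      using same_nats[OF 8(1), of 2] by simp
    \<comment> \<open>The memory update inserts \<open>f\<close>, whereas the algorithm overwrites
      the bundle; the two agree because agents in \<open>Z\<close> own nothing.\<close>
    have b: "bundles ?s3 = (bundles s)(i := {f})"
      unfolding assign_good(1)[OF f_U _ own] using state_invD(5)[OF inv i(2)] i_n
      by (subst assign_good(1)[OF f_U _ own]) auto
    have u: "unassigned ?s3 = unassigned s - {f}" using assign_good(2)[OF f_U _ own] i_n by simp
    have e: "empty_agents ?s3 = empty_agents s - {i}"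
      using same_nats[OF 8(1), of 3] by (auto simp: empty_agents_def active_def)
    have "labase_step n m v (loop_state s) (loop_state ?s3)"
      unfolding b u e using if_case[OF g(2) i(2,3) f_max] .
    then have "reach (loop_state ?s3)" using reach by (rule rtranclp.rtrancl_into_rtrancl[rotated])
    moreover have "card (unassigned ?s3) = card (unassigned s) - 1"
      unfolding u using f_U finite_unassigned by simp
    ultimately show ?case using i1 8(2) by (intro run_Seq run_NAssign) simp
  }
qed (use inpD[OF inp] N in auto)

lemma run_else:
  assumes inp: "inp s" and reach: "reach (loop_state s)"
    and g: "nats s (7, 0, 0) = g" "is_arg_max bv (\<lambda>h. h \<in> unassigned s) g"
    and Z: "\<forall>i\<in>empty_agents s. v i g = 0"
  shows "run N else_prog s (\<lambda>s'. reach (loop_state s') \<and> card (unassigned s') = card (unassigned s) - 1)"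
proof -
  have "reach (resolve_state g s)"
    using reach else_case[OF g(2) Z] by (rule rtranclp.rtrancl_into_rtrancl)
  note res = run_resolve[OF inp this]
  show ?thesis
    unfolding else_prog_def
  proof (rule run_Seq[OF run_frame[OF res]])
    fix s1 assume s1: "same (nat_arrays resolve_prog) (real_arrays resolve_prog) s s1"
      and r1: "reach (resolve_state g s1) \<and> unassigned s1 = unassigned s \<and> acyclic (envy s1) \<and> values_ok s1"
    have in1: "inp s1" using inp_same[OF s1 inp] by simp
    have "config_inv (resolve_state g s1)" using config_inv_steps r1 by blast
    then have inv: "state_inv (bundles s1) (unassigned s1) (empty_agents s1)" "\<forall>i\<in>empty_agents s1. v i g = 0"
      "g \<in> unassigned s1"
      by (simp_all add: is_arg_max_def)
    show "run N (Seq (source_prog 3) (NAssign 2 (V 7) (NConst 0) (V 13))) s1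
      (\<lambda>s'. reach (loop_state s') \<and> card (unassigned s') = card (unassigned s) - 1)"
    proof (rule run_Seq[OF run_frame[OF run_source[OF in1]]])
      fix s2 assume s2: "same (nat_arrays (source_prog 3)) (real_arrays (source_prog 3)) s1 s2"
        and r: "nats s2 (13, 0, 0) = 0 \<and> (\<forall>j\<in>active 3 s1. pred_ok (active 3 s1) s2 j) \<or>
          nats s2 (13, 0, 0) \<in> active 3 s1 \<and> (\<forall>i\<in>active 3 s1. \<not> envies s1 i (nats s2 (13, 0, 0)))"
      let ?r = "nats s2 (13, 0, 0)"
      have vals: "values_ok s1" using r1 by blast
      have re: "reals s2 (3, i, j) = reals s1 (3, i, j)" for i j using same_reals[OF s2] by simp
      have ac: "acyclic (envy s1)" using r1 by blast
      \<comment> \<open>An actual source \<open>t\<close> exists by acyclicity and can have no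
        envious predecessor, so the sweep must have ended with a source in 13.\<close>
      obtain t where "source ({1..n} - empty_agents s1) (envy s1) t"
        by (rule ex_source[OF inv(1,3,2) ac])
      then have t: "t \<in> active 3 s1" "\<And>i. i \<in> active 3 s1 \<Longrightarrow> \<not> envies s1 i t"
        using envy_iff[OF vals] unfolding source_def nonempty_agents by auto
      have "\<not> (\<forall>j\<in>active 3 s1. pred_ok (active 3 s1) s2 j)" using t unfolding re by blast
      then have r: "?r \<in> active 3 s1" "\<And>i. i \<in> active 3 s1 \<Longrightarrow> \<not> envies s1 i ?r" using r by blast+
      then have src: "source ({1..n} - empty_agents s1) (envy s1) ?r"
        using envy_iff[OF vals] unfolding source_def nonempty_agents by blast
      have r0: "?r \<noteq> 0" using r by (auto simp: active_def)
      let ?s3 = "s2\<lparr>nats := (nats s2)((2, g, 0) := ?r)\<rparr>"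
      have g2: "nats s2 (7, 0, 0) = g" using same_nats[OF s2] same_nats[OF s1] g by simp
      have own: "nats ?s3 (2, h, 0) = (if h = g then ?r else nats s1 (2, h, 0))" for h
        using same_nats[OF s2, of 2] by simp
      note upd = assign_good[OF inv(3) r0 own]
      have e: "empty_agents ?s3 = empty_agents s1"
        using same_nats[OF s2, of 3] by (auto simp: empty_agents_def active_def)
      have "labase_step n m v (resolve_state g s1) (loop_state ?s3)"
        unfolding upd e by (rule assign[OF ac src])
      moreover have "reach (resolve_state g s1)" using r1 by blast
      ultimately have "reach (loop_state ?s3)" by (rule rtranclp.rtrancl_into_rtrancl[rotated])
      moreover have "card (unassigned ?s3) = card (unassigned s) - 1"
        unfolding upd using inv(3) finite_unassigned r1 by simp
      ultimately show "run N (NAssign 2 (V 7) (NConst 0) (V 13)) s2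
        (\<lambda>s'. reach (loop_state s') \<and> card (unassigned s') = card (unassigned s) - 1)"
        using g2 by (intro run_NAssign) simp
    qed simp
  qed
qed

lemma base_ok_same: "same X Y s s' \<Longrightarrow> 1 \<notin> Y \<Longrightarrow> 2 \<notin> Y \<Longrightarrow> base_ok s \<Longrightarrow> base_ok s'"
  by (simp add: base_ok_def same_reals)

lemma run_body:
  assumes inp: "inp s" and base: "base_ok s" and reach: "reach (loop_state s)" and U: "unassigned s \<noteq> {}"
  shows "run N body_prog s (\<lambda>s'. reach (loop_state s') \<and> card (unassigned s') = card (unassigned s) - 1)"
  unfolding body_prog_def
proof (rule run_Seq, rule run_Best[where P = "\<lambda>j. j \<in> unassigned s"
    and F = "\<lambda>j. if j = 0 then 0 else (bv j)\<^sup>2"], goal_cases)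
  case (6 s' j)
  then show ?case using same_nats[OF 6(1)] inpD(2)[OF inp] by (simp add: unassigned_def output_bundles_def)
next
  case (7 s' w)
  then show ?case using same_reals[OF 7(1)] base inpD(2)[OF inp] by (auto simp: base_ok_def)
next
  case (8 s1 g)
  have un: "unassigned s \<subseteq> {1..m}" by (auto simp: unassigned_def output_bundles_def)
  then have g: "g \<in> {1..m}" "g \<in> unassigned s" and max: "\<And>j. j \<in> unassigned s \<Longrightarrow> (bv j)\<^sup>2 \<le> (bv g)\<^sup>2"
    using 8(3) U inpD(2)[OF inp] by (auto split: if_splits)
  \<comment> \<open>Base values are positive, so maximising their squares maximises them.\<close>
  have "bv j \<le> bv g" if "j \<in> unassigned s" for j
    using max[OF that] base_value_pos[OF g(1)] by (rule power2_le_imp_le[OF _ less_imp_le])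
  then have am: "is_arg_max bv (\<lambda>h. h \<in> unassigned s) g" using g by (auto simp: is_arg_max_def not_less)
  have in1: "inp s1" using inp_same[OF 8(1) inp] by simp
  show ?case
  proof (rule run_Seq, rule run_Find[where P = "\<lambda>j. j \<in> empty_agents s \<and> 0 < v j g"], goal_cases)
    case (5 s' j)
    have j: "j \<in> {1..n}" using 5(3) inpD(1)[OF in1] by simp
    have "inp s'" using inp_same[OF 5(1) in1] by simp
    then have "reals s' (0, j, g) = v j g" using inpD(3) j g(1) by blast
    moreover have "nats s' (7, 0, 0) = g" "nats s' (3, j, 0) = nats s (3, j, 0)"
      using same_nats[OF 5(1)] same_nats[OF 8(1)] 8(2) by auto
    ultimately show ?case using 5(2) j by (simp add: empty_agents_def active_def)
  next
    case (6 s2 i)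
    have in2: "inp s2" using inp_same[OF 6(1) in1] by simp
    have eq: "bundles s2 = bundles s" "unassigned s2 = unassigned s" "empty_agents s2 = empty_agents s"
      using state_same[OF 6(1)] state_same[OF 8(1)] by auto
    have base2: "base_ok s2" using base_ok_same[OF 6(1)] base_ok_same[OF 8(1)] base by simp
    have reach2: "reach (loop_state s2)" unfolding eq by (rule reach)
    have g2: "nats s2 (7, 0, 0) = g" using same_nats[OF 6(1)] 8(2) by simp
    have am2: "is_arg_max bv (\<lambda>h. h \<in> unassigned s2) g" unfolding eq by (rule am)
    show ?case
    proof (rule run_Cond)
      assume "bval (NLess (NConst 0) (V 8)) s2"
      then have "i \<in> empty_agents s2" "0 < v i g" using 6(2,3) unfolding eq by auto
      then show "run N if_prog s2 (\<lambda>s'. reach (loop_state s') \<and> card (unassigned s') = card (unassigned s) - 1)"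
        using run_if[OF in2 base2 reach2 g2 am2 6(2)] unfolding eq by blast
    next
      assume "\<not> bval (NLess (NConst 0) (V 8)) s2"
      then have none: "\<not> (j \<in> empty_agents s \<and> 0 < v j g)" if "j \<in> {1..n}" for j
        using 6(2,3) inpD(1)[OF in1] that by auto
      have "v j g = 0" if j: "j \<in> empty_agents s2" for j
      proof -
        have "j \<in> {1..n}" using j by (simp add: empty_agents_def)
        then show ?thesis using none[of j] v_nonneg[of j g] g(1) j unfolding eq by force
      qed
      then show "run N else_prog s2 (\<lambda>s'. reach (loop_state s') \<and> card (unassigned s') = card (unassigned s) - 1)"
        using run_else[OF in2 reach2 g2 am2] unfolding eq by blast
    qed
  qed (use inpD[OF in1] N in auto)
qed (use inpD[OF inp] N in auto)

lemma run_labase: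
  "run N labase_prog (input_mem n m v) (\<lambda>s. labase_output n m v (output_bundles m s))"
proof -
  let ?s = "input_mem n m v"
  have inp: "inp ?s" by (auto simp: inp_def input_mem_def)
  have zero: "reals ?s (1, 0, 0) = 0" by (simp add: input_mem_def)
  show ?thesis
    unfolding labase_prog_def
  proof (rule run_Seq[OF run_frame[OF run_base[OF inp zero]]])
    fix s1 assume s1: "same (nat_arrays base_prog) (real_arrays base_prog) ?s s1" "base_ok s1"
    have in1: "inp s1" using inp_same[OF s1(1) inp] by simp
    have init: "bundles s1 = (\<lambda>_. {})" "unassigned s1 = {1..m}" "empty_agents s1 = {1..n}"
      using state_same[OF s1(1)]
      by (auto simp: bundles_def unassigned_def empty_agents_def active_def output_bundles_def input_mem_def fun_eq_iff)
    let ?I = "\<lambda>k s'. reach (loop_state s') \<and> card (unassigned s') = m - k"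
    show "run N (For 17 1 body_prog) s1 (\<lambda>s. labase_output n m v (output_bundles m s))"
    proof (rule run_For[where I = ?I], goal_cases)
      case 5
      then show ?case by (simp add: init labase_init_def)
    next
      case (6 k s' j)
      have "same {17} {} s' (s'\<lparr>nats := (nats s')((17, 0, 0) := j)\<rparr>)" by (simp add: same_def)
      from state_same[OF this] show ?case using 6 by simp
    next
      case (7 k s')
      have "inp s'" using inp_same[OF 7(4) in1] by simp
      moreover have "base_ok s'" using base_ok_same[OF 7(4) _ _ s1(2)] by simp
      moreover have "unassigned s' \<noteq> {}" using 7(1,2) inpD(2)[OF in1] by auto
      ultimately show ?case using 7(2) by (intro run_frame[OF run_body[of s']]) auto
    next
      case (8 s')
      then have "unassigned s' = {}" using inpD(2)[OF in1] finite_unassigned[of s'] by simp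
      \<comment> \<open>The two differ at most at index 0, which collects the unassigned goods, and
        none is left.\<close>
      moreover from this have "output_bundles m s' = bundles s'"
        by (auto simp: fun_eq_iff bundles_def unassigned_def)
      ultimately show ?case using 8(1) unfolding labase_output_def by metis
    qed (use inpD[OF in1] N in auto)
  qed
qed

end

text \<open>The program and the polynomial are chosen before the instance, so both are uniform. The
  guarantee covers all ways of making the open choices, while the program only has to realise one of
  them.\<close>

theorem theorem1:
  shows "\<exists>(prog :: com) (p :: nat poly). \<forall>n m v \<gamma>.
    fair_division_instance n m v \<and> \<gamma> = range_param n m v \<and> \<gamma> \<in> {0<..1} \<longrightarrow>
      (\<forall>k c. (labase_step n m v ^^ k) (labase_init n m) c \<longrightarrow>
         k \<le> poly p (n + m) \<and> ((\<exists>c'. labase_step n m v c c') \<or> (\<exists>A Z. c = Loop A {} Z))) \<and>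
      (\<forall>A. labase_output n m v A \<longrightarrow>
         allocation n m A \<and> approx_efx (2 * \<gamma> / (sqrt (5 + 4 * \<gamma>) - 1)) n m v A) \<and>
      (\<exists>t s. exec prog (input_mem n m v) t s \<and> t \<le> poly p (n + m) \<and>
         labase_output n m v (output_bundles m s))"
proof -
  \<comment> \<open>With \<open>x = n + m\<close>, the polynomial x^3 + x^2 + 2 x dominates the step
    bound \<open>(n * n + 2) * m\<close> as well as the loop bounds \<open>n\<close>,
    \<open>m\<close> and \<open>n * n + 1\<close>, so it can serve as \<open>N\<close>.\<close>
  define q :: "nat poly" where "q = [:0, 2, 1, 1:]"
  define p where "p = q + pcompose (cost labase_prog) q"
  have q: "poly q x = 2 * x + x * x + x * x * x" for x by (simp add: q_def algebra_simps)
  show ?thesis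
  proof (intro exI[of _ labase_prog] exI[of _ p] allI impI)
    fix n m v and \<gamma> :: real
    assume "fair_division_instance n m v \<and> \<gamma> = range_param n m v \<and> \<gamma> \<in> {0<..1}"
    then have \<gamma>: "\<gamma> = range_param n m v" and inst: "fd_instance n m v"
      by (auto simp: fd_instance_def)
    interpret fd_instance n m v by (rule inst)
    have nm: "n * n \<le> (n + m) * (n + m)" "m * (n * n) \<le> (n + m) * ((n + m) * (n + m))"
      by (intro mult_le_mono; simp)+
    interpret fd_program n m v "poly q (n + m)"
      using nm n_pos by unfold_locales (auto simp: q)
    have bound: "poly q (n + m) \<le> poly p (n + m)" "poly (cost labase_prog) (poly q (n + m)) \<le> poly p (n + m)"
      by (auto simp: p_def poly_pcompose)
    show "(\<forall>k c. (labase_step n m v ^^ k) (labase_init n m) c \<longrightarrow>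
         k \<le> poly p (n + m) \<and> ((\<exists>c'. labase_step n m v c c') \<or> (\<exists>A Z. c = Loop A {} Z))) \<and>
      (\<forall>A. labase_output n m v A \<longrightarrow>
         allocation n m A \<and> approx_efx (2 * \<gamma> / (sqrt (5 + 4 * \<gamma>) - 1)) n m v A) \<and>
      (\<exists>t s. exec labase_prog (input_mem n m v) t s \<and> t \<le> poly p (n + m) \<and>
         labase_output n m v (output_bundles m s))"
    proof (intro conjI allI impI)
      fix k c assume "(labase_step n m v ^^ k) (labase_init n m) c"
      note b = steps_bound[OF this]
      have "(n * n + 2) * m \<le> poly q (n + m)" using nm(2) by (simp add: q algebra_simps)
      then show "k \<le> poly p (n + m)" using b bound(1) by linarith
      show "(\<exists>c'. labase_step n m v c c') \<or> (\<exists>A Z. c = Loop A {} Z)" using progress b by blast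
    next
      fix A assume "labase_output n m v A"
      from output_correct[OF this] show "allocation n m A"
        "approx_efx (2 * \<gamma> / (sqrt (5 + 4 * \<gamma>) - 1)) n m v A" unfolding \<gamma> .
    next
      show "\<exists>t s. exec labase_prog (input_mem n m v) t s \<and> t \<le> poly p (n + m) \<and>
         labase_output n m v (output_bundles m s)"
        using run_labase bound(2) unfolding run_def by (meson order_trans)
    qed
  qed
qed

end
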